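(* Let $T(t,\tau)$ be an evolution family on a Banach space $X$ admitting a strong nonuniform polynomial dichotomy with constant $\epsilon\ge0$, and let $B:[1,\infty)\to B(X)$ be strongly continuous with $\|B(t)\|\le c/t^{1+\epsilon}$ for all $t\ge1$, for some $c>0$. Let $U(t,\tau)$ be the evolution family satisfying $$U(t,\tau)=T(t,\tau)+\int_\tau^tT(t,s)B(s)U(s,\tau)\,ds,\quad t\ge\tau\ge1.$$ Then, provided $c>0$ is sufficiently small, $U(t,\tau)$ admits a strong nonuniform polynomial dichotomy.
   Context: Let $X$ be a Banach space with norm $\|\cdot\|$ and $B(X)$ the space of bounded linear operators on $X$. An evolution family is a family of bounded linear operators $T(t,\tau)$ on $X$, $t\ge\tau\ge1$, such that $T(t,t)=\mathrm{Id}$ for $t\ge1$, $T(t,s)T(s,\tau)=T(t,\tau)$ for $t\ge s\ge\tau\ge1$, and for each $\tau\ge1$ and $x\in X$ the map $s\mapsto T(s,\tau)x$ is continuous on $[\tau,\infty)$. $T(t,\tau)$ admits a nonuniform polynomial dichotomy if there are projections $P(t)$, $t\ge1$, with $P(t)T(t,\tau)=T(t,\tau)P(\tau)$ for $t\ge\tau\ge1$ and $T(t,\tau)|_{\ker P(\tau)}:\ker P(\tau)\to\ker P(t)$ invertible for $t\ge\tau\ge1$, and constants $\lambda,D>0$, $\epsilon\ge0$ such that for $t,\tau\ge1$: $\|T(t,\tau)P(\tau)\|\le D(t/\tau)^{-\lambda}\tau^\epsilon$ for $t\ge\tau$ and $\|T(t,\tau)Q(\tau)\|\le D(\tau/t)^{-\lambda}\tau^\epsilon$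 for $t\le\tau$, where $Q(t)=\mathrm{Id}-P(t)$ and for $t<\tau$, $T(t,\tau)=(T(\tau,t)|_{\ker P(t)})^{-1}:\ker P(\tau)\to\ker P(t)$. It admits a strong nonuniform polynomial dichotomy if in addition there are $K,b>0$ with $\|T(t,\tau)\|\le K(t/\tau)^b\tau^\epsilon$ for all $t\ge\tau\ge1$. *)

theory Defs
  imports "HOL-Analysis.Analysis"
begin

definition evolution_family :: "(real \<Rightarrow> real \<Rightarrow> ('a::banach \<Rightarrow>\<^sub>L 'a)) \<Rightarrow> bool" where
  "evolution_family T \<longleftrightarrow>
     (\<forall>t\<ge>1. T t t = id_blinfun) \<and>
     (\<forall>t s \<tau>. t \<ge> s \<and> s \<ge> \<tau> \<and> \<tau> \<ge> 1 \<longrightarrow> T t s o\<^sub>L T s \<tau> = T t \<tau>) \<and>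
     (\<forall>\<tau>\<ge>1. \<forall>x. continuous_on {\<tau>..} (\<lambda>s. blinfun_apply (T s \<tau>) x))"

definition kerP :: "('a::banach \<Rightarrow>\<^sub>L 'a) \<Rightarrow> 'a set" where
  "kerP A = {x. blinfun_apply A x = 0}"

(* Nonuniform polynomial dichotomy with projections P and constants lam, D, eps.
  For t \<le> tau, T(t,tau) Q(tau) is the inverse of T(tau,t) restricted to ker P(t),
  applied to Q(tau) x = x - P(tau) x; the operator-norm bound is written pointwise.*)

definition npd_with :: "(real \<Rightarrow> real \<Rightarrow> ('a::banach \<Rightarrow>\<^sub>L 'a)) \<Rightarrow> (real \<Rightarrow> ('a \<Rightarrow>\<^sub>L 'a))
    \<Rightarrow> real \<Rightarrow> real \<Rightarrow> real \<Rightarrow> bool" where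
  "npd_with T P lam D eps \<longleftrightarrow>
     lam > 0 \<and> D > 0 \<and> eps \<ge> 0 \<and>
     (\<forall>t\<ge>1. P t o\<^sub>L P t = P t) \<and>
     (\<forall>t \<tau>. t \<ge> \<tau> \<and> \<tau> \<ge> 1 \<longrightarrow> P t o\<^sub>L T t \<tau> = T t \<tau> o\<^sub>L P \<tau>) \<and>
     (\<forall>t \<tau>. t \<ge> \<tau> \<and> \<tau> \<ge> 1 \<longrightarrow>
        bij_betw (blinfun_apply (T t \<tau>)) (kerP (P \<tau>)) (kerP (P t))) \<and>
     (\<forall>t \<tau>. t \<ge> \<tau> \<and> \<tau> \<ge> 1 \<longrightarrow>
        norm (T t \<tau> o\<^sub>L P \<tau>) \<le> D * (t / \<tau>) powr (- lam) * \<tau> powr eps) \<and>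
     (\<forall>t \<tau>. 1 \<le> t \<and> t \<le> \<tau> \<longrightarrow> (\<forall>x. \<forall>y\<in>kerP (P t).
        blinfun_apply (T \<tau> t) y = x - blinfun_apply (P \<tau>) x \<longrightarrow>
        norm y \<le> D * (\<tau> / t) powr (- lam) * \<tau> powr eps * norm x))"

definition strong_npd_with :: "(real \<Rightarrow> real \<Rightarrow> ('a::banach \<Rightarrow>\<^sub>L 'a)) \<Rightarrow> real \<Rightarrow> bool" where
  "strong_npd_with T eps \<longleftrightarrow>
     (\<exists>P lam D. npd_with T P lam D eps) \<and>
     (\<exists>K b. K > 0 \<and> b > 0 \<and> (\<forall>t \<tau>. t \<ge> \<tau> \<and> \<tau> \<ge> 1 \<longrightarrow>
        norm (T t \<tau>) \<le> K * (t / \<tau>) powr b * \<tau> powr eps))"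

definition strong_npd :: "(real \<Rightarrow> real \<Rightarrow> ('a::banach \<Rightarrow>\<^sub>L 'a)) \<Rightarrow> bool" where
  "strong_npd T \<longleftrightarrow> (\<exists>eps. strong_npd_with T eps)"

end

theory Submission
  imports Defs
begin

text \<open>
  The dichotomy of \<open>T\<close> becomes uniform when measured in Lyapunov seminorms: a stable one \<open>a\<close> that \<open>T\<close>
  contracts by \<open>(t/\<tau>) powr -lam\<close>, and an unstable one \<open>b\<close> that \<open>T\<close> expands by at least \<open>(t/\<tau>) powr lam\<close>
  and at most \<open>(t/\<tau>) powr bet\<close>; their sum is at least the norm and at most \<open>const * t powr eps\<close> times it.
  The decay of \<open>B\<close> absorbs this factor, so on \<open>{\<tau>..q\<tau>}\<close>, with \<open>q powr lam = 4\<close>, the families \<open>U\<close> and \<open>T\<close>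
  are uniformly close. Hence \<open>U\<close> preserves the cone \<open>a \<le> b\<close> and doubles \<open>b\<close> on it over each such interval.
  The stable space of \<open>U\<close> at \<open>\<tau>\<close> consists of the vectors with bounded orbit (they stay in \<open>b \<le> a\<close>), the
  unstable one is \<open>U \<tau> 1\<close> applied to the kernel of \<open>P 1\<close>. They span because a vector injected at
  time \<open>\<tau>\<close> can be continued to a bounded solution on the grid \<open>q ^ n\<close> starting in that kernel.
\<close>

section \<open>Seminorms\<close>

definition seminorm :: "('a::real_vector \<Rightarrow> real) \<Rightarrow> bool" where
  "seminorm p \<longleftrightarrow> (\<forall>x y. p (x + y) \<le> p x + p y) \<and> (\<forall>r x. p (r *\<^sub>R x) = \<bar>r\<bar> * p x)"

lemma seminorm_triangle: "seminorm p \<Longrightarrow> p (x + y) \<le> p x + p y"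
  by (simp add: seminorm_def)

lemma seminorm_scaleR: "seminorm p \<Longrightarrow> p (r *\<^sub>R x) = \<bar>r\<bar> * p x"
  by (simp add: seminorm_def)

lemma seminorm_zero: "seminorm p \<Longrightarrow> p 0 = 0"
  using seminorm_scaleR[of p 0 0] by simp

lemma seminorm_minus: "seminorm p \<Longrightarrow> p (- x) = p x"
  using seminorm_scaleR[of p "-1" x] by simp

lemma seminorm_nonneg: "seminorm p \<Longrightarrow> 0 \<le> p x"
  using seminorm_triangle[of p x "- x"] seminorm_minus[of p x] seminorm_zero[of p] by simp

lemma seminorm_diff_le: "seminorm p \<Longrightarrow> p (x - y) \<le> p x + p y"
  using seminorm_triangle[of p x "- y"] seminorm_minus[of p y] by simp

lemma seminorm_le_diff: "seminorm p \<Longrightarrow> p x \<le> p y + p (x - y)"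
  using seminorm_triangle[of p y "x - y"] by simp

lemma seminorm_minus_commute: "seminorm p \<Longrightarrow> p (x - y) = p (y - x)"
  using seminorm_minus[of p "x - y"] by simp

lemma seminorm_eqI:
  assumes "seminorm p" "p (x - y) = 0"
  shows "p x = p y"
  using seminorm_le_diff[OF assms(1), of x y] seminorm_le_diff[OF assms(1), of y x]
    seminorm_minus_commute[OF assms(1), of x y] assms(2) by simp

lemma seminorm_sum_le: "seminorm p \<Longrightarrow> p (sum f A) \<le> (\<Sum>i\<in>A. p (f i))"
proof (induction A rule: infinite_finite_induct)
  case (insert i A)
  then show ?case using seminorm_triangle[of p "f i" "sum f A"] by simp
qed (simp_all add: seminorm_zero)

lemma seminorm_add: "seminorm p \<Longrightarrow> seminorm q \<Longrightarrow> seminorm (\<lambda>x. p x + q x)"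
  unfolding seminorm_def
proof (intro conjI allI; elim conjE)
  fix x y
  assume "\<forall>x y. p (x + y) \<le> p x + p y" "\<forall>x y. q (x + y) \<le> q x + q y"
  then have "p (x + y) \<le> p x + p y" "q (x + y) \<le> q x + q y" by blast+
  then show "p (x + y) + q (x + y) \<le> p x + q x + (p y + q y)" by linarith
qed (simp add: distrib_left)

lemma seminorm_norm_linear:
  assumes "linear f" "0 \<le> w"
  shows "seminorm (\<lambda>x. norm (f x) * w)"
  unfolding seminorm_def
proof (intro conjI allI)
  fix x y
  show "norm (f (x + y)) * w \<le> norm (f x) * w + norm (f y) * w"
    using mult_right_mono[OF norm_triangle_ineq[of "f x" "f y"] assms(2)]
    by (simp add: linear_add[OF assms(1)] algebra_simps)
qed (simp add: linear_scale[OF assms(1)])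

lemma seminorm_SUP:
  assumes sn: "\<And>i. i \<in> I \<Longrightarrow> seminorm (p i)"
    and bd: "\<And>x. bdd_above ((\<lambda>i. p i x) ` I)" and "I \<noteq> {}"
  shows "seminorm (\<lambda>x. SUP i\<in>I. p i x)"
  unfolding seminorm_def
proof (intro conjI allI)
  fix x y
  show "(SUP i\<in>I. p i (x + y)) \<le> (SUP i\<in>I. p i x) + (SUP i\<in>I. p i y)"
  proof (intro cSUP_least[OF \<open>I \<noteq> {}\<close>])
    fix i assume i: "i \<in> I"
    show "p i (x + y) \<le> (SUP i\<in>I. p i x) + (SUP i\<in>I. p i y)"
      using seminorm_triangle[OF sn[OF i], of x y] cSUP_upper[OF i bd[of x]]
        cSUP_upper[OF i bd[of y]] by linarith
  qed
next
  have le: "(SUP i\<in>I. p i (r *\<^sub>R x)) \<le> \<bar>r\<bar> * (SUP i\<in>I. p i x)" for r x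
    by (intro cSUP_least[OF \<open>I \<noteq> {}\<close>])
       (auto simp: seminorm_scaleR[OF sn] intro!: mult_left_mono cSUP_upper bd)
  fix r x
  show "(SUP i\<in>I. p i (r *\<^sub>R x)) = \<bar>r\<bar> * (SUP i\<in>I. p i x)"
  proof (cases "r = 0")
    case True
    then show ?thesis using \<open>I \<noteq> {}\<close> by (simp add: seminorm_zero[OF sn])
  next
    case False
    \<comment> \<open>The reverse inequality is \<open>le\<close> itself, applied to the scalar
      \<open>1 / r\<close> and the vector \<open>r *\<^sub>R x\<close>.\<close>
    have "\<bar>r\<bar> * (SUP i\<in>I. p i x) \<le> (SUP i\<in>I. p i (r *\<^sub>R x))"
      using le[of "1 / r" "r *\<^sub>R x"] False by (simp add: field_simps)
    then show ?thesis using le[of r x] by simp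
  qed
qed

text \<open>Finite subadditivity passes to series because domination by the norm sends the seminorm
  of the remainder to 0.\<close>

lemma seminorm_suminf_le:
  fixes d :: "nat \<Rightarrow> 'a::real_normed_vector"
  assumes p: "seminorm p" and bd: "\<And>x. p x \<le> C * norm x"
    and d: "d sums z" and e: "\<And>k. p (d k) \<le> e k" "e sums S"
  shows "p z \<le> S"
proof -
  have "(\<lambda>n. (\<Sum>k<n. e k) + C * norm (z - (\<Sum>k<n. d k))) \<longlonglongrightarrow> S + C * norm (z - z)"
    using d e(2) unfolding sums_def by (intro tendsto_intros)
  moreover have "p z \<le> (\<Sum>k<n. e k) + C * norm (z - (\<Sum>k<n. d k))" for n
    using seminorm_le_diff[OF p, of z "\<Sum>k<n. d k"] bd[of "z - (\<Sum>k<n. d k)"]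
      seminorm_sum_le[OF p, of d "{..<n}"] sum_mono[of "{..<n}" "\<lambda>k. p (d k)" e] e(1)
    by fastforce
  ultimately show ?thesis by (intro LIMSEQ_le_const) auto
qed

text \<open>The bound holds for every Riemann sum by subadditivity, and domination by the norm
  carries it over to the gauge integral. Neither measurability nor integrability of \<open>p\<close>
  along \<open>h\<close> enters.\<close>

lemma seminorm_has_integral_le:
  fixes h :: "real \<Rightarrow> 'a::real_normed_vector"
  assumes p: "seminorm p" and bd: "\<And>x. p x \<le> C * norm x"
    and h: "(h has_integral i) {u..v}" and "u \<le> v"
    and M: "\<And>s. s \<in> {u..v} \<Longrightarrow> p (h s) \<le> M"
  shows "p i \<le> M * (v - u)"
proof (rule field_le_epsilon)
  fix e :: real assume "e > 0"
  \<comment> \<open>\<open>C\<close> may be zero or negative, so \<open>\<bar>C\<bar> + 1\<close>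
    serves as a positive divisor.\<close>
  define e' where "e' = e / (\<bar>C\<bar> + 1)"
  have C1: "\<bar>C\<bar> + 1 > 0" by linarith
  have "e' > 0" using \<open>e > 0\<close> C1 by (simp add: e'_def)
  from h[unfolded has_integral_real, rule_format, OF this]
  obtain \<gamma> where \<gamma>: "gauge \<gamma>" and fine: "\<forall>\<D>. \<D> tagged_division_of {u..v} \<and> \<gamma> fine \<D> \<longrightarrow>
      norm ((\<Sum>(x,k)\<in>\<D>. measure lborel k *\<^sub>R h x) - i) < e'"
    by (elim exE conjE) (rule that)
  obtain \<D> where \<D>: "\<D> tagged_division_of {u..v}" "\<gamma> fine \<D>"
    by (rule fine_division_exists_real[OF \<gamma>])
  define S where "S = (\<Sum>(x,k)\<in>\<D>. measure lborel k *\<^sub>R h x)"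
  have "p S \<le> (\<Sum>y\<in>\<D>. p (case y of (x, k) \<Rightarrow> measure lborel k *\<^sub>R h x))"
    unfolding S_def by (rule seminorm_sum_le[OF p])
  also have "\<dots> \<le> (\<Sum>(x,k)\<in>\<D>. measure lborel k * M)"
  proof (rule sum_mono)
    fix y assume "y \<in> \<D>"
    then obtain x k where y: "y = (x, k)" "(x, k) \<in> \<D>" by (cases y) auto
    then have "x \<in> {u..v}"
      using tagged_division_ofD(2)[OF \<D>(1) y(2)] tagged_division_ofD(3)[OF \<D>(1) y(2)] by auto
    then show "p (case y of (x, k) \<Rightarrow> measure lborel k *\<^sub>R h x)
        \<le> (case y of (x, k) \<Rightarrow> measure lborel k * M)"
      using M y by (simp add: seminorm_scaleR[OF p] mult_left_mono)
  qed
  also have "\<dots> = M * (v - u)"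
  proof -
    have "(\<Sum>(x,k)\<in>\<D>. measure lborel k * M) = (\<Sum>(x,k)\<in>\<D>. measure lborel k) * M"
      by (simp add: sum_distrib_right case_prod_unfold)
    then show ?thesis
      using additive_content_tagged_division[of \<D> u v] \<D>(1) \<open>u \<le> v\<close> by simp
  qed
  finally have S: "p S \<le> M * (v - u)" .
  have "p (i - S) \<le> C * norm (i - S)" by (rule bd)
  also have "\<dots> \<le> (\<bar>C\<bar> + 1) * norm (i - S)" by (intro mult_right_mono) auto
  also have "\<dots> \<le> (\<bar>C\<bar> + 1) * e'"
    using fine[rule_format, OF conjI, OF \<D>] by (intro mult_left_mono) (auto simp: S_def norm_minus_commute)
  also have "\<dots> = e" using C1 by (simp add: e'_def)
  finally show "p i \<le> M * (v - u) + e"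
    using seminorm_le_diff[OF p, of i S] S by linarith
qed

section \<open>Evolution families and projections\<close>

lemma evolution_family_refl: "evolution_family T \<Longrightarrow> 1 \<le> t \<Longrightarrow> T t t x = x"
  by (simp add: evolution_family_def)

lemma evolution_family_comp:
  "evolution_family T \<Longrightarrow> \<tau> \<le> s \<Longrightarrow> s \<le> t \<Longrightarrow> 1 \<le> \<tau> \<Longrightarrow> T t s (T s \<tau> x) = T t \<tau> x"
  by (simp add: evolution_family_def flip: blinfun_apply_blinfun_compose)

lemma evolution_family_continuous:
  "evolution_family T \<Longrightarrow> 1 \<le> \<tau> \<Longrightarrow> continuous_on {\<tau>..} (\<lambda>s. T s \<tau> x)"
  by (simp add: evolution_family_def)

text \<open>Two decompositions of a vector differ by an element of \<open>E \<inter> F\<close>, so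
  the chosen component is unique and therefore linear. The pointwise norm bound gives continuity
  directly, in place of a closed graph argument.\<close>

lemma ex_bounded_projection:
  fixes E F :: "'a::real_normed_vector set"
  assumes sub: "subspace E" "subspace F" and dir: "E \<inter> F = {0}"
    and ex: "\<And>x. \<exists>e\<in>E. x - e \<in> F \<and> norm e \<le> C * norm x"
  shows "\<exists>P :: 'a \<Rightarrow>\<^sub>L 'a. \<forall>x e. P x = e \<longleftrightarrow> e \<in> E \<and> x - e \<in> F"
proof -
  obtain f where f: "\<And>x. f x \<in> E" "\<And>x. x - f x \<in> F" "\<And>x. norm (f x) \<le> C * norm x"
  proof -
    from ex have "\<forall>x. \<exists>e. e \<in> E \<and> x - e \<in> F \<and> norm e \<le> C * norm x" by blast
    from choice[OF this] obtain f
      where "\<forall>x. f x \<in> E \<and> x - f x \<in> F \<and> norm (f x) \<le> C * norm x" ..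
    then show ?thesis by (intro that[of f]) simp_all
  qed
  have uniq: "f x = e" if "e \<in> E" "x - e \<in> F" for x e
  proof -
    have "f x - e \<in> E" by (rule subspace_diff[OF sub(1) f(1) that(1)])
    moreover have "(x - e) - (x - f x) \<in> F"
      by (rule subspace_diff[OF sub(2) that(2) f(2)])
    ultimately have "f x - e \<in> E \<inter> F" by simp
    then show ?thesis using dir by simp
  qed
  have "bounded_linear f"
  proof (rule bounded_linear_intro[where K = C])
    fix x y r
    show "f (x + y) = f x + f y"
      using subspace_add[OF sub(1) f(1)[of x] f(1)[of y]] subspace_add[OF sub(2) f(2)[of x] f(2)[of y]]
      by (intro uniq) (simp_all add: algebra_simps)
    show "f (r *\<^sub>R x) = r *\<^sub>R f x"
      using subspace_scale[OF sub(1) f(1)[of x]] subspace_scale[OF sub(2) f(2)[of x]]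
      by (intro uniq) (simp_all add: scaleR_diff_right)
    show "norm (f x) \<le> norm x * C" using f(3)[of x] by (simp add: mult.commute)
  qed
  then have "blinfun_apply (Blinfun f) = f" by (rule bounded_linear_Blinfun_apply)
  then have "Blinfun f x = e \<longleftrightarrow> e \<in> E \<and> x - e \<in> F" for x e
    using uniq[of e x] f(1,2)[of x] by auto
  then show ?thesis by blast
qed

lemma ex_geometric_interval:
  fixes q t \<tau> :: real
  assumes "1 < q" "0 < \<tau>" "\<tau> \<le> t"
  shows "\<exists>n. q ^ n * \<tau> \<le> t \<and> t < q ^ Suc n * \<tau>"
proof -
  obtain n where "t / \<tau> < q ^ n" using real_arch_pow[OF \<open>1 < q\<close>] by blast
  then have ex: "\<exists>n. t < q ^ n * \<tau>" using assms by (auto simp: field_simps)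
  define n where "n = (LEAST n. t < q ^ n * \<tau>)"
  have n: "t < q ^ n * \<tau>" unfolding n_def by (rule LeastI_ex[OF ex])
  then obtain k where k: "n = Suc k" using assms by (cases n) auto
  have "\<not> t < q ^ k * \<tau>" using not_less_Least[of k "\<lambda>n. t < q ^ n * \<tau>"] k by (simp add: n_def)
  then show ?thesis using n k by (intro exI[of _ k]) auto
qed

section \<open>Adapted seminorms\<close>

text \<open>Assuming \<open>lam \<le> bet\<close> loses no generality, since the growth exponent can
  always be enlarged.\<close>

locale strong_dichotomy =
  fixes T :: "real \<Rightarrow> real \<Rightarrow> ('a::banach \<Rightarrow>\<^sub>L 'a)" and P :: "real \<Rightarrow> ('a \<Rightarrow>\<^sub>L 'a)"
    and lam D eps K bet :: real
  assumes evol: "evolution_family T" and dich: "npd_with T P lam D eps"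
    and K_pos: "0 < K" and lam_le_bet: "lam \<le> bet"
    and growth: "\<And>t \<tau>. \<tau> \<le> t \<Longrightarrow> 1 \<le> \<tau> \<Longrightarrow> norm (T t \<tau>) \<le> K * (t / \<tau>) powr bet * \<tau> powr eps"
begin

lemma lam_pos: "0 < lam" and D_pos: "0 < D"
  using dich by (simp_all add: npd_with_def)

lemma proj_idem: "1 \<le> t \<Longrightarrow> P t (P t x) = P t x"
  using dich by (simp add: npd_with_def flip: blinfun_apply_blinfun_compose)

lemma proj_commute: "\<tau> \<le> t \<Longrightarrow> 1 \<le> \<tau> \<Longrightarrow> P t (T t \<tau> x) = T t \<tau> (P \<tau> x)"
  using dich by (simp add: npd_with_def flip: blinfun_apply_blinfun_compose)

lemma bij_ker: "\<tau> \<le> t \<Longrightarrow> 1 \<le> \<tau> \<Longrightarrow> bij_betw (T t \<tau>) (kerP (P \<tau>)) (kerP (P t))"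
  using dich by (simp add: npd_with_def)

lemma stable_bound:
  assumes "\<tau> \<le> t" "1 \<le> \<tau>"
  shows "norm (T t \<tau> (P \<tau> x)) \<le> D * (t / \<tau>) powr (- lam) * \<tau> powr eps * norm x"
proof -
  have "norm (T t \<tau> (P \<tau> x)) \<le> norm (T t \<tau> o\<^sub>L P \<tau>) * norm x"
    using norm_blinfun[of "T t \<tau> o\<^sub>L P \<tau>" x] by simp
  also have "\<dots> \<le> D * (t / \<tau>) powr (- lam) * \<tau> powr eps * norm x"
    using dich assms by (intro mult_right_mono) (simp_all add: npd_with_def)
  finally show ?thesis .
qed

section \<open>Backward evolution on the kernels of the projections\<close>

lemma diff_proj_in_ker: "1 \<le> t \<Longrightarrow> x - P t x \<in> kerP (P t)"
  by (simp add: kerP_def blinfun.diff_right proj_idem)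

text \<open>For \<open>s \<le> t\<close> this is the operator T(s,t)Q(t) of the dichotomy.\<close>

definition pullback :: "real \<Rightarrow> real \<Rightarrow> 'a \<Rightarrow> 'a" where
  "pullback s t x = inv_into (kerP (P s)) (T t s) (x - P t x)"

lemma pullback_in_ker: "s \<le> t \<Longrightarrow> 1 \<le> s \<Longrightarrow> pullback s t x \<in> kerP (P s)"
  using bij_betw_imp_surj_on[OF bij_ker[of s t]] diff_proj_in_ker[of t x]
  unfolding pullback_def by (intro inv_into_into) simp

lemma apply_pullback: "s \<le> t \<Longrightarrow> 1 \<le> s \<Longrightarrow> T t s (pullback s t x) = x - P t x"
  using bij_betw_imp_surj_on[OF bij_ker[of s t]] diff_proj_in_ker[of t x]
  unfolding pullback_def by (intro f_inv_into_f) simp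

lemma pullback_unique:
  assumes "s \<le> t" "1 \<le> s" "y \<in> kerP (P s)" "T t s y = x - P t x"
  shows "pullback s t x = y"
  using bij_betw_imp_inj_on[OF bij_ker[OF assms(1,2)]] pullback_in_ker[OF assms(1,2), of x]
    apply_pullback[OF assms(1,2), of x] assms(3,4) by (simp add: inj_on_def)

lemma pullback_bound:
  assumes "s \<le> t" "1 \<le> s"
  shows "norm (pullback s t x) \<le> D * (t / s) powr (- lam) * t powr eps * norm x"
  using dich assms pullback_in_ker[OF assms] apply_pullback[OF assms] unfolding npd_with_def by simp

lemma pullback_bounded_linear:
  assumes "s \<le> t" "1 \<le> s"
  shows "bounded_linear (pullback s t)"
proof (rule bounded_linear_intro)
  fix x y r
  show "pullback s t (x + y) = pullback s t x + pullback s t y"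
    using pullback_in_ker[OF assms] apply_pullback[OF assms]
    by (intro pullback_unique[OF assms]) (simp_all add: kerP_def blinfun.add_right)
  show "pullback s t (r *\<^sub>R x) = r *\<^sub>R pullback s t x"
    using pullback_in_ker[OF assms] apply_pullback[OF assms]
    by (intro pullback_unique[OF assms]) (simp_all add: kerP_def blinfun.scaleR_right scaleR_diff_right)
  show "norm (pullback s t x) \<le> norm x * (D * (t / s) powr (- lam) * t powr eps)"
    using pullback_bound[OF assms, of x] by (simp add: mult_ac)
qed

text \<open>The evolution on the kernels of the projections, in both time directions.\<close>

definition unst :: "real \<Rightarrow> real \<Rightarrow> 'a \<Rightarrow> 'a" where
  "unst s t x = (if t \<le> s then T s t (x - P t x) else pullback s t x)"

lemma linear_unst:
  assumes "1 \<le> s" "1 \<le> t"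
  shows "linear (unst s t)"
proof (cases "t \<le> s")
  case True
  then show ?thesis
    by (intro linearI) (simp_all add: unst_def blinfun.bilinear_simps algebra_simps)
next
  case False
  then show ?thesis
    using bounded_linear.linear[OF pullback_bounded_linear[of s t]] assms by (simp add: unst_def[abs_def])
qed

text \<open>The unstable component at time \<open>s\<close> can be read off from any point of an
  orbit, whether \<open>s\<close> lies before, between or after the two times. Comparing the suprema
  at \<open>\<tau>\<close> and at \<open>t\<close> thus reduces to comparing weights.\<close>

lemma unst_evolution:
  assumes "\<tau> \<le> t" "1 \<le> \<tau>" "1 \<le> s"
  shows "unst s t (T t \<tau> x) = unst s \<tau> x"
proof -
  have *: "T t \<tau> x - P t (T t \<tau> x) = T t \<tau> (x - P \<tau> x)"
    using assms by (simp add: proj_commute blinfun.diff_right)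
  consider "t \<le> s" | "\<tau> \<le> s" "s < t" | "s < \<tau>" by linarith
  then show ?thesis
  proof cases
    case 1
    then show ?thesis using assms by (simp add: unst_def * evolution_family_comp[OF evol])
  next
    case 2
    have "P s (T s \<tau> (x - P \<tau> x)) = 0"
      using 2 assms by (simp add: proj_commute blinfun.diff_right proj_idem)
    then have "pullback s t (T t \<tau> x) = T s \<tau> (x - P \<tau> x)"
      using 2 assms by (intro pullback_unique) (simp_all add: * evolution_family_comp[OF evol] kerP_def)
    then show ?thesis using 2 by (simp add: unst_def)
  next
    case 3
    have "T t s (pullback s \<tau> x) = T t \<tau> (T \<tau> s (pullback s \<tau> x))"
      using 3 assms by (simp add: evolution_family_comp[OF evol])
    also have "\<dots> = T t \<tau> (x - P \<tau> x)" using 3 assms by (simp add: apply_pullback)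
    finally have "pullback s t (T t \<tau> x) = pullback s \<tau> x"
      using 3 assms by (intro pullback_unique pullback_in_ker) (simp_all add: *)
    then show ?thesis using 3 assms by (simp add: unst_def)
  qed
qed

lemma unst_proj: "1 \<le> s \<Longrightarrow> 1 \<le> t \<Longrightarrow> unst s t (P t x) = 0"
  using pullback_unique[of s t 0 "P t x"] by (auto simp: unst_def proj_idem kerP_def)

lemma unst_refl: "1 \<le> t \<Longrightarrow> unst t t x = x - P t x"
  by (simp add: unst_def evolution_family_refl[OF evol])

text \<open>Since \<open>lam \<le> bet\<close>, this is \<open>(t/s) powr lam\<close> for \<open>s \<le> t\<close> and \<open>(t/s) powr bet\<close> for \<open>s \<ge> t\<close>.\<close>

definition wgt :: "real \<Rightarrow> real \<Rightarrow> real" where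
  "wgt s t = min ((t / s) powr lam) ((t / s) powr bet)"

lemma wgt_nonneg: "0 \<le> wgt s t"
  by (simp add: wgt_def)

text \<open>Passing from \<open>\<tau>\<close> to \<open>t\<close> multiplies the two powers by
  \<open>(t / \<tau>) powr lam\<close> and \<open>(t / \<tau>) powr bet\<close>, so their minimum
  grows by a factor in between. The two bounds become \<open>unst_expand\<close> and
  \<open>unst_growth\<close>.\<close>

lemma wgt_mono:
  assumes "\<tau> \<le> t" "1 \<le> \<tau>" "1 \<le> s"
  shows "(t / \<tau>) powr lam * wgt s \<tau> \<le> wgt s t" "wgt s t \<le> (t / \<tau>) powr bet * wgt s \<tau>"
proof -
  have r: "(t / s) powr u = (t / \<tau>) powr u * (\<tau> / s) powr u" for u
    using assms by (simp flip: powr_mult)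
  have le: "(t / \<tau>) powr lam \<le> (t / \<tau>) powr bet"
    using assms lam_le_bet by (intro powr_mono) auto
  have nn: "0 \<le> (t / \<tau>) powr u" "0 \<le> (\<tau> / s) powr u" for u by simp_all
  show "(t / \<tau>) powr lam * wgt s \<tau> \<le> wgt s t"
    unfolding wgt_def r
    by (intro min.boundedI mult_mono min.cobounded1 min.cobounded2 le nn order_refl)
  have "wgt s t \<le> min ((t / \<tau>) powr bet * (\<tau> / s) powr lam) ((t / \<tau>) powr bet * (\<tau> / s) powr bet)"
    unfolding wgt_def r by (intro min.mono mult_right_mono le nn order_refl)
  also have "\<dots> = (t / \<tau>) powr bet * wgt s \<tau>"
    unfolding wgt_def by (simp add: min_mult_distrib_left)
  finally show "wgt s t \<le> (t / \<tau>) powr bet * wgt s \<tau>" .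
qed

text \<open>The weight compensates the decay of the stable part, which keeps the supremum finite and
  turns the nonuniform bound into a contraction with constant 1.\<close>

definition sta_seminorm :: "real \<Rightarrow> 'a \<Rightarrow> real" where
  "sta_seminorm t x = (SUP s\<in>{t..}. norm (T s t (P t x)) * (s / t) powr lam)"

text \<open>Past times \<open>s\<close> measure expansion. Future times are included so that every
  term at \<open>t\<close> has a counterpart at an earlier \<open>\<tau>\<close>, which yields an
  upper growth bound; their finiteness is where the strong dichotomy is used.\<close>

definition unst_seminorm :: "real \<Rightarrow> 'a \<Rightarrow> real" where
  "unst_seminorm t x = (SUP s\<in>{1..}. norm (unst s t x) * wgt s t)"

section \<open>Comparison of the adapted seminorms with the norm\<close>

lemma sta_term_bound:
  assumes "1 \<le> t" "t \<le> s"
  shows "norm (T s t (P t x)) * (s / t) powr lam \<le> D * t powr eps * norm x"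
proof -
  have "norm (T s t (P t x)) * (s / t) powr lam
      \<le> D * (s / t) powr (- lam) * t powr eps * norm x * (s / t) powr lam"
    using assms by (intro mult_right_mono stable_bound) simp_all
  also have "\<dots> = D * t powr eps * norm x * ((s / t) powr (- lam) * (s / t) powr lam)"
    by (simp add: mult_ac)
  also have "(s / t) powr (- lam) * (s / t) powr lam = 1"
    using assms by (simp flip: powr_add)
  finally show ?thesis by simp
qed

text \<open>Past times are controlled by the dichotomy and future times by the growth bound, where
  subtracting the stable part \<open>P t x\<close> costs the additional \<open>D\<close>.\<close>

lemma unst_term_bound:
  assumes "1 \<le> t" "1 \<le> s"
  shows "norm (unst s t x) * wgt s t \<le> (K + D) * t powr eps * norm x"
proof (cases "t \<le> s")
  case False
  have "norm (unst s t x) * wgt s t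
      \<le> D * (t / s) powr (- lam) * t powr eps * norm x * (t / s) powr lam"
    using assms False D_pos pullback_bound[of s t x] by (intro mult_mono) (simp_all add: unst_def wgt_def)
  also have "\<dots> = D * t powr eps * norm x * ((t / s) powr (- lam) * (t / s) powr lam)"
    by (simp add: mult_ac)
  also have "(t / s) powr (- lam) * (t / s) powr lam = 1"
    using assms by (simp flip: powr_add)
  also have "D * t powr eps * norm x * 1 \<le> (K + D) * t powr eps * norm x"
    using K_pos by (simp add: mult_right_mono)
  finally show ?thesis .
next
  case True
  have "norm (unst s t x) \<le> norm (T s t x) + norm (T s t (P t x))"
    using True by (simp add: unst_def blinfun.diff_right norm_triangle_ineq4)
  also have "norm (T s t x) \<le> K * (s / t) powr bet * t powr eps * norm x"
    using norm_blinfun[of "T s t" x] mult_right_mono[OF growth[OF True assms(1)], of "norm x"]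
    by simp
  also have "norm (T s t (P t x)) \<le> D * (s / t) powr (- lam) * t powr eps * norm x"
    by (rule stable_bound[OF True assms(1)])
  also have "\<dots> \<le> D * (s / t) powr bet * t powr eps * norm x"
    using True assms lam_pos lam_le_bet D_pos
    by (intro mult_right_mono mult_left_mono powr_mono) simp_all
  finally have "norm (unst s t x) \<le> (K + D) * (s / t) powr bet * t powr eps * norm x"
    by (simp add: algebra_simps)
  then have "norm (unst s t x) * wgt s t
      \<le> (K + D) * (s / t) powr bet * t powr eps * norm x * (t / s) powr bet"
    using K_pos D_pos wgt_nonneg by (intro mult_mono) (simp_all add: wgt_def)
  also have "\<dots> = (K + D) * t powr eps * norm x * ((s / t) powr bet * (t / s) powr bet)"
    by (simp add: mult_ac)
  also have "(s / t) powr bet * (t / s) powr bet = 1"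
    using assms by (simp flip: powr_mult)
  finally show ?thesis by simp
qed

lemma sta_bdd: "1 \<le> t \<Longrightarrow> bdd_above ((\<lambda>s. norm (T s t (P t x)) * (s / t) powr lam) ` {t..})"
  using sta_term_bound by (auto intro!: bdd_aboveI2)

lemma unst_bdd: "1 \<le> t \<Longrightarrow> bdd_above ((\<lambda>s. norm (unst s t x) * wgt s t) ` {1..})"
  using unst_term_bound by (auto intro!: bdd_aboveI2)

lemma seminorm_sta: "1 \<le> t \<Longrightarrow> seminorm (sta_seminorm t)"
  unfolding sta_seminorm_def[abs_def]
  by (intro seminorm_SUP sta_bdd seminorm_norm_linear linearI)
     (simp_all add: blinfun.bilinear_simps)

lemma seminorm_unst: "1 \<le> t \<Longrightarrow> seminorm (unst_seminorm t)"
  unfolding unst_seminorm_def[abs_def]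
  by (intro seminorm_SUP unst_bdd seminorm_norm_linear linear_unst wgt_nonneg) auto

text \<open>The terms with \<open>s = t\<close> in the two suprema are the norms of
  \<open>P t x\<close> and \<open>x - P t x\<close>.\<close>

lemma norm_le_adapted:
  assumes "1 \<le> t"
  shows "norm x \<le> sta_seminorm t x + unst_seminorm t x"
proof -
  have "norm (T t t (P t x)) * (t / t) powr lam \<le> sta_seminorm t x"
    unfolding sta_seminorm_def by (rule cSUP_upper[OF _ sta_bdd[OF assms]]) simp
  then have "norm (P t x) \<le> sta_seminorm t x"
    using assms by (simp add: evolution_family_refl[OF evol])
  moreover have "norm (unst t t x) * wgt t t \<le> unst_seminorm t x"
    unfolding unst_seminorm_def by (rule cSUP_upper[OF _ unst_bdd[OF assms]]) (simp add: assms)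
  then have "norm (x - P t x) \<le> unst_seminorm t x"
    using assms by (simp add: unst_refl wgt_def)
  ultimately show ?thesis using norm_triangle_sub[of x "P t x"] by simp
qed

lemma adapted_le_norm:
  assumes "1 \<le> t"
  shows "sta_seminorm t x + unst_seminorm t x \<le> (K + 2 * D) * t powr eps * norm x"
proof -
  have "sta_seminorm t x \<le> D * t powr eps * norm x"
    unfolding sta_seminorm_def using assms by (intro cSUP_least sta_term_bound) auto
  moreover have "unst_seminorm t x \<le> (K + D) * t powr eps * norm x"
    unfolding unst_seminorm_def using assms by (intro cSUP_least unst_term_bound) auto
  ultimately show ?thesis by (simp add: algebra_simps)
qed

lemma sta_diff_proj: "1 \<le> t \<Longrightarrow> sta_seminorm t (x - P t x) = 0"
  by (simp add: sta_seminorm_def blinfun.diff_right proj_idem)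

lemma unst_seminorm_proj: "1 \<le> t \<Longrightarrow> unst_seminorm t (P t x) = 0"
  unfolding unst_seminorm_def by (simp add: unst_proj cong: SUP_cong_simp)

section \<open>Uniform contraction and expansion of \<open>T\<close> in the adapted
  seminorms\<close>

lemma sta_contract:
  assumes "\<tau> \<le> t" "1 \<le> \<tau>"
  shows "sta_seminorm t (T t \<tau> x) \<le> (t / \<tau>) powr (- lam) * sta_seminorm \<tau> x"
  unfolding sta_seminorm_def[of t]
proof (rule cSUP_least)
  fix s assume s: "s \<in> {t..}"
  have "(s / t) powr lam = (t / \<tau>) powr (- lam) * (s / \<tau>) powr lam"
    using s assms by (simp add: powr_minus powr_divide field_simps)
  moreover have "T s t (P t (T t \<tau> x)) = T s \<tau> (P \<tau> x)"
    using s assms by (simp add: proj_commute evolution_family_comp[OF evol])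
  moreover have "norm (T s \<tau> (P \<tau> x)) * (s / \<tau>) powr lam \<le> sta_seminorm \<tau> x"
    unfolding sta_seminorm_def using s assms by (intro cSUP_upper sta_bdd) auto
  ultimately show "norm (T s t (P t (T t \<tau> x))) * (s / t) powr lam
      \<le> (t / \<tau>) powr (- lam) * sta_seminorm \<tau> x"
    by (metis mult.left_commute mult_left_mono powr_ge_zero)
qed simp

lemma unst_expand:
  assumes "\<tau> \<le> t" "1 \<le> \<tau>"
  shows "(t / \<tau>) powr lam * unst_seminorm \<tau> x \<le> unst_seminorm t (T t \<tau> x)"
proof -
  have pos: "0 < (t / \<tau>) powr lam" using assms by simp
  have "unst_seminorm \<tau> x \<le> unst_seminorm t (T t \<tau> x) / (t / \<tau>) powr lam"
    unfolding unst_seminorm_def[of \<tau>]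
  proof (rule cSUP_least)
    fix s :: real assume s: "s \<in> {1..}"
    have "norm (unst s \<tau> x) * ((t / \<tau>) powr lam * wgt s \<tau>) \<le> norm (unst s \<tau> x) * wgt s t"
      using s assms by (intro mult_left_mono wgt_mono) simp_all
    also have "\<dots> = norm (unst s t (T t \<tau> x)) * wgt s t"
      using s assms by (simp add: unst_evolution)
    also have "\<dots> \<le> unst_seminorm t (T t \<tau> x)"
      unfolding unst_seminorm_def using s assms by (intro cSUP_upper unst_bdd) auto
    finally show "norm (unst s \<tau> x) * wgt s \<tau> \<le> unst_seminorm t (T t \<tau> x) / (t / \<tau>) powr lam"
      unfolding pos_le_divide_eq[OF pos] by (simp add: mult_ac)
  qed simp
  then show ?thesis unfolding pos_le_divide_eq[OF pos] by (simp add: mult_ac)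
qed

lemma unst_growth:
  assumes "\<tau> \<le> t" "1 \<le> \<tau>"
  shows "unst_seminorm t (T t \<tau> x) \<le> (t / \<tau>) powr bet * unst_seminorm \<tau> x"
  unfolding unst_seminorm_def[of t]
proof (rule cSUP_least)
  fix s :: real assume s: "s \<in> {1..}"
  have "norm (unst s t (T t \<tau> x)) * wgt s t = norm (unst s \<tau> x) * wgt s t"
    using s assms by (simp add: unst_evolution)
  also have "\<dots> \<le> norm (unst s \<tau> x) * ((t / \<tau>) powr bet * wgt s \<tau>)"
    using s assms by (intro mult_left_mono wgt_mono) simp_all
  also have "\<dots> = (t / \<tau>) powr bet * (norm (unst s \<tau> x) * wgt s \<tau>)" by (simp add: mult_ac)
  also have "\<dots> \<le> (t / \<tau>) powr bet * unst_seminorm \<tau> x"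
    unfolding unst_seminorm_def using s assms by (intro mult_left_mono cSUP_upper unst_bdd) auto
  finally show "norm (unst s t (T t \<tau> x)) * wgt s t \<le> (t / \<tau>) powr bet * unst_seminorm \<tau> x" .
qed simp

definition adapted :: "real \<Rightarrow> 'a \<Rightarrow> real" where
  "adapted t x = sta_seminorm t x + unst_seminorm t x"

lemma seminorm_adapted: "1 \<le> t \<Longrightarrow> seminorm (adapted t)"
  unfolding adapted_def[abs_def] by (intro seminorm_add seminorm_sta seminorm_unst)

lemma sta_le_adapted: "1 \<le> t \<Longrightarrow> sta_seminorm t x \<le> adapted t x"
  by (simp add: adapted_def seminorm_nonneg[OF seminorm_unst])

lemma unst_le_adapted: "1 \<le> t \<Longrightarrow> unst_seminorm t x \<le> adapted t x"
  by (simp add: adapted_def seminorm_nonneg[OF seminorm_sta])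

text \<open>Over one interval of this ratio \<open>T\<close> contracts and expands by 4. Errors of
  size 1/8 leave a factor 2 for \<open>U\<close>, which corresponds to the exponent
  \<open>lam / 2\<close> (see \<open>ratio_power_half\<close>).\<close>

definition ratio :: real where
  "ratio = 4 powr (1 / lam)"

lemma ratio_gt_1: "1 < ratio"
  unfolding ratio_def using lam_pos by (intro gr_one_powr) auto

lemma ratio_powr_lam: "ratio powr lam = 4"
  using lam_pos by (simp add: ratio_def powr_powr)

lemma ratio_power_powr: "(ratio ^ n) powr u = (ratio powr u) ^ n"
  using ratio_gt_1 by (induction n) (simp_all add: powr_mult)

lemma ratio_power_half: "(ratio ^ n) powr (lam / 2) = 2 ^ n"
proof -
  have "(ratio powr (lam / 2))\<^sup>2 = 2\<^sup>2"
    by (simp add: ratio_powr_lam power2_eq_square flip: powr_add)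
  then have "ratio powr (lam / 2) = 2"
    by (metis power2_eq_imp_eq powr_ge_zero zero_le_numeral)
  then show ?thesis by (simp add: ratio_power_powr)
qed

lemma one_le_ratio_power: "1 \<le> ratio ^ n"
  using ratio_gt_1 by (simp add: one_le_power)

lemma one_le_ratio_powr_bet: "1 \<le> ratio powr bet"
  using ratio_gt_1 lam_pos lam_le_bet by (intro ge_one_powr_ge_zero) auto

lemma adapted_growth:
  assumes "1 \<le> \<tau>" "\<tau> \<le> t" "t \<le> ratio * \<tau>"
  shows "adapted t (T t \<tau> x) \<le> ratio powr bet * adapted \<tau> x"
proof -
  have "sta_seminorm t (T t \<tau> x) \<le> (t / \<tau>) powr (- lam) * sta_seminorm \<tau> x"
    using assms by (intro sta_contract) auto
  also have "\<dots> \<le> ratio powr bet * sta_seminorm \<tau> x"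
  proof (rule mult_right_mono)
    have "(t / \<tau>) powr (- lam) \<le> (t / \<tau>) powr 0"
      using assms lam_pos by (intro powr_mono) auto
    then show "(t / \<tau>) powr (- lam) \<le> ratio powr bet"
      using one_le_ratio_powr_bet assms by simp
  qed (use assms in \<open>simp add: seminorm_nonneg[OF seminorm_sta]\<close>)
  finally have 1: "sta_seminorm t (T t \<tau> x) \<le> ratio powr bet * sta_seminorm \<tau> x" .
  have "unst_seminorm t (T t \<tau> x) \<le> (t / \<tau>) powr bet * unst_seminorm \<tau> x"
    using assms by (intro unst_growth) auto
  also have "\<dots> \<le> ratio powr bet * unst_seminorm \<tau> x"
    using assms lam_pos lam_le_bet seminorm_nonneg[OF seminorm_unst[OF assms(1)]]
    by (intro mult_right_mono powr_mono2) (auto simp: field_simps)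
  finally show ?thesis using 1 by (simp add: adapted_def distrib_left)
qed

text \<open>This is \<open>unst_expand\<close> read backwards; discarding \<open>P t x\<close> is
  free because \<open>unst_seminorm\<close> vanishes on the range of the projection.\<close>

lemma unst_pullback:
  assumes "\<tau> \<le> t" "1 \<le> \<tau>"
  shows "unst_seminorm \<tau> (pullback \<tau> t x) \<le> (t / \<tau>) powr (- lam) * unst_seminorm t x"
proof -
  have "(t / \<tau>) powr lam * unst_seminorm \<tau> (pullback \<tau> t x) \<le> unst_seminorm t (x - P t x)"
    using unst_expand[OF assms, of "pullback \<tau> t x"] assms by (simp add: apply_pullback)
  also have "\<dots> \<le> unst_seminorm t x"
    using seminorm_diff_le[OF seminorm_unst, of t x "P t x"] unst_seminorm_proj[of t x] assms by simp
  finally show ?thesis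
    using assms by (simp add: powr_minus field_simps)
qed

lemma sta_zero_of_ker: "1 \<le> t \<Longrightarrow> P t x = 0 \<Longrightarrow> sta_seminorm t x = 0"
  using sta_diff_proj[of t x] by simp

text \<open>The inner product \<open>ratio powr bet * ratio * (K + 2 * D)\<close> is the constant of
  the integral estimate in \<open>perturbation_close\<close>. The remaining factor
  \<open>16 * ratio powr bet\<close> brings the final error down to 1/8.\<close>

definition smallness :: real where
  "smallness = 1 / (16 * (ratio powr bet * ratio * (K + 2 * D)) * ratio powr bet)"

lemma smallness_pos: "0 < smallness"
  using ratio_gt_1 K_pos D_pos by (simp add: smallness_def)

text \<open>A bound for the supremum of \<open>U s \<tau> x\<close> over \<open>s \<in> {\<tau>..ratio * \<tau>}\<close> is absorbed into the left-hand
  side of the integral equation; being constant in \<open>s\<close>, it requires no measurability.\<close>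

lemma perturbation_close:
  fixes B :: "real \<Rightarrow> ('a \<Rightarrow>\<^sub>L 'a)" and U :: "real \<Rightarrow> real \<Rightarrow> ('a \<Rightarrow>\<^sub>L 'a)"
  assumes U: "evolution_family U" and c: "0 < c" "c < smallness"
    and B: "\<And>t. 1 \<le> t \<Longrightarrow> norm (B t) \<le> c / t powr (1 + eps)"
    and int: "\<And>t \<tau> x. \<tau> \<le> t \<Longrightarrow> 1 \<le> \<tau> \<Longrightarrow>
      ((\<lambda>s. T t s (B s (U s \<tau> x))) has_integral (U t \<tau> x - T t \<tau> x)) {\<tau>..t}"
    and \<tau>: "1 \<le> \<tau>" "\<tau> \<le> t" "t \<le> ratio * \<tau>"
  shows "adapted t (U t \<tau> x - T t \<tau> x) \<le> adapted \<tau> x / 8"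
proof -
  define C where "C = K + 2 * D"
  define \<rho> where "\<rho> = ratio powr bet"
  define I where "I = {\<tau>..ratio * \<tau>}"
  define M where "M = (SUP s\<in>I. adapted s (U s \<tau> x))"
  have C: "0 < C" using K_pos D_pos by (simp add: C_def)
  have \<rho>: "1 \<le> \<rho>" using one_le_ratio_powr_bet by (simp add: \<rho>_def)
  have eps: "0 \<le> eps" using dich by (simp add: npd_with_def)
  have I1: "1 \<le> s" if "s \<in> I" for s using that \<tau> by (simp add: I_def)
  have "I \<noteq> {}" using \<tau> ratio_gt_1 by (auto simp: I_def)
  have Cn: "adapted s y \<le> C * s powr eps * norm y" if "1 \<le> s" for s y
    using adapted_le_norm[OF that] by (simp add: adapted_def C_def)
  \<comment> \<open>The orbit is bounded on the compact interval, so \<open>M\<close> is a genuine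
    supremum.\<close>
  have "compact ((\<lambda>s. U s \<tau> x) ` I)"
    unfolding I_def
    by (intro compact_continuous_image continuous_on_subset[OF evolution_family_continuous[OF U \<tau>(1)]]) auto
  then obtain R where R: "\<And>s. s \<in> I \<Longrightarrow> norm (U s \<tau> x) \<le> R"
    using compact_imp_bounded bounded_iff by (metis imageI)
  have "adapted s (U s \<tau> x) \<le> C * (ratio * \<tau>) powr eps * R" if "s \<in> I" for s
    using Cn[OF I1[OF that], of "U s \<tau> x"] R[OF that] C eps that \<tau>
    by (elim order_trans) (intro mult_mono powr_mono2; auto simp: I_def)
  then have bdd: "bdd_above ((\<lambda>s. adapted s (U s \<tau> x)) ` I)"
    by (rule bdd_aboveI2)
  have M: "adapted s (U s \<tau> x) \<le> M" if "s \<in> I" for s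
    unfolding M_def by (rule cSUP_upper[OF that bdd])
  have diff: "adapted r (U r \<tau> x - T r \<tau> x) \<le> \<rho> * ratio * C * c * M" if r: "r \<in> I" for r
  proof -
    have M0: "0 \<le> M"
      using M[OF r] seminorm_nonneg[OF seminorm_adapted[OF I1[OF r]], of "U r \<tau> x"] by linarith
    have "adapted r (U r \<tau> x - T r \<tau> x) \<le> \<rho> * C * c * M / \<tau> * (r - \<tau>)"
    proof (rule seminorm_has_integral_le[OF seminorm_adapted[OF I1[OF r]] Cn[OF I1[OF r]] int])
      fix s assume s: "s \<in> {\<tau>..r}"
      have s1: "1 \<le> s" "s \<in> I" using s \<tau> r by (auto simp: I_def)
      have "r \<le> ratio * s" using r s ratio_gt_1
        by (auto simp: I_def intro: order_trans mult_left_mono)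
      then have "adapted r (T r s (B s (U s \<tau> x))) \<le> \<rho> * adapted s (B s (U s \<tau> x))"
        unfolding \<rho>_def using s s1 by (intro adapted_growth) auto
      also have "\<dots> \<le> \<rho> * (C * s powr eps * norm (B s (U s \<tau> x)))"
        using \<rho> Cn[OF s1(1)] by (intro mult_left_mono) auto
      also have "\<dots> \<le> \<rho> * (C * s powr eps * (c / s powr (1 + eps) * M))"
      proof -
        have "norm (B s (U s \<tau> x)) \<le> norm (B s) * norm (U s \<tau> x)" by (rule norm_blinfun)
        also have "\<dots> \<le> c / s powr (1 + eps) * M"
          using B[OF s1(1)] M[OF s1(2)] norm_le_adapted[OF s1(1), of "U s \<tau> x"] c
          by (intro mult_mono) (auto simp: adapted_def)
        finally show ?thesis using \<rho> C by (intro mult_left_mono) auto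
      qed
      \<comment> \<open>The factor \<open>s powr eps\<close> from the adapted norm cancels against
        the decay of \<open>B\<close>; only \<open>1 / s\<close> is left.\<close>
      also have "\<dots> = \<rho> * C * c * M / s"
        using s1 by (simp add: powr_add field_simps)
      also have "\<dots> \<le> \<rho> * C * c * M / \<tau>"
        using s \<tau> \<rho> C c M0 by (intro divide_left_mono) auto
      finally show "adapted r (T r s (B s (U s \<tau> x))) \<le> \<rho> * C * c * M / \<tau>" .
    qed (use r \<tau> in \<open>auto simp: I_def\<close>)
    \<comment> \<open>The length of the interval is at most \<open>ratio * \<tau>\<close>, which
      cancels \<open>1 / \<tau>\<close> and makes the bound independent of
      \<open>\<tau>\<close>.\<close>
    also have "\<dots> \<le> \<rho> * C * c * M / \<tau> * (ratio * \<tau>)"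
      using r \<tau> \<rho> C c M0 by (intro mult_left_mono) (auto simp: I_def)
    also have "\<dots> = \<rho> * ratio * C * c * M" using \<tau> by simp
    finally show ?thesis .
  qed
  have kc: "16 * (\<rho> * ratio * C * c) * \<rho> \<le> 1"
  proof -
    have pos: "0 < 16 * (\<rho> * ratio * C) * \<rho>" using ratio_gt_1 C \<rho> by simp
    have "c < 1 / (16 * (\<rho> * ratio * C) * \<rho>)"
      using c(2) unfolding smallness_def C_def \<rho>_def .
    then have "c * (16 * (\<rho> * ratio * C) * \<rho>) < 1" unfolding pos_less_divide_eq[OF pos] .
    then show ?thesis by (simp add: mult_ac)
  qed
  have k0: "0 \<le> \<rho> * ratio * C * c" using ratio_gt_1 C \<rho> c by simp
  have k16: "16 * (\<rho> * ratio * C * c) \<le> 1"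
    using mult_left_mono[OF \<rho>, of "16 * (\<rho> * ratio * C * c)"] kc k0 by simp
  have M0: "0 \<le> M"
    using M[of \<tau>] seminorm_nonneg[OF seminorm_adapted[OF \<tau>(1)], of "U \<tau> \<tau> x"] \<tau> ratio_gt_1
    by (simp add: I_def)
  have N0: "0 \<le> adapted \<tau> x" by (rule seminorm_nonneg[OF seminorm_adapted[OF \<tau>(1)]])
  have "M \<le> \<rho> * adapted \<tau> x + \<rho> * ratio * C * c * M"
    unfolding M_def
  proof (rule cSUP_least[OF \<open>I \<noteq> {}\<close>], fold M_def)
    fix s assume s: "s \<in> I"
    show "adapted s (U s \<tau> x) \<le> \<rho> * adapted \<tau> x + \<rho> * ratio * C * c * M"
      using seminorm_le_diff[OF seminorm_adapted[OF I1[OF s]], of "U s \<tau> x" "T s \<tau> x"] diff[OF s]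
        adapted_growth[of \<tau> s x] s \<tau> by (simp add: I_def \<rho>_def)
  qed
  moreover have "16 * (\<rho> * ratio * C * c * M) \<le> M"
    using mult_right_mono[OF k16 M0] by simp
  \<comment> \<open>The term containing \<open>M\<close> on the right is at most
    \<open>M / 16\<close> and is absorbed.\<close>
  ultimately have "M \<le> 2 * \<rho> * adapted \<tau> x" using M0 by linarith
  then have "\<rho> * ratio * C * c * M \<le> \<rho> * ratio * C * c * (2 * \<rho> * adapted \<tau> x)"
    by (rule mult_left_mono[OF _ k0])
  also have "\<dots> = 16 * (\<rho> * ratio * C * c) * \<rho> * adapted \<tau> x / 8" by simp
  also have "\<dots> \<le> adapted \<tau> x / 8"
    using divide_right_mono[OF mult_right_mono[OF kc N0] zero_le_numeral] by (simp only: mult_1_left)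
  finally show ?thesis using diff[of t] \<tau> by (simp add: I_def)
qed

end

section \<open>Evolution families close to a dichotomy\<close>

text \<open>All that is retained of the perturbation is an error of at most 1/8 in the adapted norm
  over one interval of ratio \<open>ratio\<close>.\<close>

locale close_evolution = strong_dichotomy +
  fixes U :: "real \<Rightarrow> real \<Rightarrow> ('a \<Rightarrow>\<^sub>L 'a)"
  assumes evolU: "evolution_family U"
    and close: "\<And>t \<tau> x. 1 \<le> \<tau> \<Longrightarrow> \<tau> \<le> t \<Longrightarrow> t \<le> ratio * \<tau> \<Longrightarrow>
      adapted t (U t \<tau> x - T t \<tau> x) \<le> adapted \<tau> x / 8"
begin

section \<open>One-step estimates for \<open>U\<close>\<close>

lemma compU: "\<tau> \<le> s \<Longrightarrow> s \<le> t \<Longrightarrow> 1 \<le> \<tau> \<Longrightarrow> U t s (U s \<tau> x) = U t \<tau> x"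
  by (rule evolution_family_comp[OF evolU])

lemma ratio_mult_ge: "1 \<le> \<tau> \<Longrightarrow> \<tau> \<le> ratio * \<tau>"
  using ratio_gt_1 by simp

lemma sta_U:
  assumes "1 \<le> \<tau>" "\<tau> \<le> t" "t \<le> ratio * \<tau>"
  shows "sta_seminorm t (U t \<tau> x) \<le> (t / \<tau>) powr (- lam) * sta_seminorm \<tau> x + adapted \<tau> x / 8"
proof -
  have t: "1 \<le> t" using assms by simp
  show ?thesis
    using seminorm_le_diff[OF seminorm_sta[OF t], of "U t \<tau> x" "T t \<tau> x"] close[OF assms, of x]
      sta_le_adapted[OF t, of "U t \<tau> x - T t \<tau> x"] sta_contract[OF assms(2,1), of x] by linarith
qed

lemma unst_U:
  assumes "1 \<le> \<tau>" "\<tau> \<le> t" "t \<le> ratio * \<tau>"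
  shows "(t / \<tau>) powr lam * unst_seminorm \<tau> x \<le> unst_seminorm t (U t \<tau> x) + adapted \<tau> x / 8"
proof -
  have t: "1 \<le> t" using assms by simp
  show ?thesis
    using seminorm_le_diff[OF seminorm_unst[OF t], of "T t \<tau> x" "U t \<tau> x"] close[OF assms, of x]
      seminorm_minus_commute[OF seminorm_unst[OF t], of "T t \<tau> x" "U t \<tau> x"]
      unst_le_adapted[OF t, of "U t \<tau> x - T t \<tau> x"] unst_expand[OF assms(2,1), of x] by linarith
qed

lemma sta_U_le:
  assumes "1 \<le> \<tau>" "\<tau> \<le> t" "t \<le> ratio * \<tau>"
  shows "sta_seminorm t (U t \<tau> x) \<le> sta_seminorm \<tau> x + adapted \<tau> x / 8"
proof -
  have "(t / \<tau>) powr (- lam) \<le> (t / \<tau>) powr 0"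
    using assms lam_pos by (intro powr_mono) auto
  then have "(t / \<tau>) powr (- lam) \<le> 1" using assms by simp
  then have "(t / \<tau>) powr (- lam) * sta_seminorm \<tau> x \<le> sta_seminorm \<tau> x"
    by (rule mult_left_le_one_le[OF seminorm_nonneg[OF seminorm_sta[OF assms(1)]] powr_ge_zero])
  then show ?thesis using sta_U[OF assms, of x] by linarith
qed

lemma unst_U_ge:
  assumes "1 \<le> \<tau>" "\<tau> \<le> t" "t \<le> ratio * \<tau>"
  shows "unst_seminorm \<tau> x \<le> unst_seminorm t (U t \<tau> x) + adapted \<tau> x / 8"
proof -
  have "1 \<le> (t / \<tau>) powr lam"
    using assms lam_pos by (intro ge_one_powr_ge_zero) auto
  then have "1 * unst_seminorm \<tau> x \<le> (t / \<tau>) powr lam * unst_seminorm \<tau> x"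
    by (rule mult_right_mono[OF _ seminorm_nonneg[OF seminorm_unst[OF assms(1)]]])
  then show ?thesis using unst_U[OF assms, of x] by linarith
qed

lemma sta_U_ratio:
  assumes "1 \<le> \<tau>"
  shows "sta_seminorm (ratio * \<tau>) (U (ratio * \<tau>) \<tau> x) \<le> sta_seminorm \<tau> x / 4 + adapted \<tau> x / 8"
  using sta_U[OF assms ratio_mult_ge[OF assms] order_refl, of x] assms
  by (simp add: powr_minus ratio_powr_lam)

lemma unst_U_ratio:
  assumes "1 \<le> \<tau>"
  shows "4 * unst_seminorm \<tau> x \<le> unst_seminorm (ratio * \<tau>) (U (ratio * \<tau>) \<tau> x) + adapted \<tau> x / 8"
  using unst_U[OF assms ratio_mult_ge[OF assms] order_refl, of x] assms
  by (simp add: ratio_powr_lam)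

text \<open>The first summand is the growth of \<open>T\<close> over one step; the 1 generously
  covers the error 1/8.\<close>

definition step_growth :: real where
  "step_growth = ratio powr bet + 1"

lemma step_growth_gt_1: "1 < step_growth"
  using one_le_ratio_powr_bet unfolding step_growth_def by linarith

lemma adapted_U:
  assumes "1 \<le> \<tau>" "\<tau> \<le> t" "t \<le> ratio * \<tau>"
  shows "adapted t (U t \<tau> x) \<le> step_growth * adapted \<tau> x"
proof -
  have t: "1 \<le> t" using assms by simp
  show ?thesis
    using seminorm_le_diff[OF seminorm_adapted[OF t], of "U t \<tau> x" "T t \<tau> x"] close[OF assms, of x]
      adapted_growth[OF assms, of x] seminorm_nonneg[OF seminorm_adapted[OF assms(1)], of x]
    unfolding step_growth_def distrib_right by linarith
qed

section \<open>Invariance of the unstable cone and expansion in it\<close>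

lemma ratio_power_mult: "1 \<le> \<tau> \<Longrightarrow> 1 \<le> ratio ^ n * \<tau>" "1 \<le> \<tau> \<Longrightarrow> \<tau> \<le> ratio ^ n * \<tau>"
  using one_le_ratio_power[of n] mult_mono[of 1 "ratio ^ n" 1 \<tau>] by auto

lemma U_ratio_Suc:
  assumes "1 \<le> \<tau>"
  shows "U (ratio ^ Suc n * \<tau>) \<tau> x = U (ratio * (ratio ^ n * \<tau>)) (ratio ^ n * \<tau>) (U (ratio ^ n * \<tau>) \<tau> x)"
  using compU[of \<tau> "ratio ^ n * \<tau>" "ratio * (ratio ^ n * \<tau>)" x] ratio_power_mult[OF assms, of n] assms
    ratio_mult_ge[of "ratio ^ n * \<tau>"] by (simp add: mult.assoc)

text \<open>Write a and b for the stable and unstable seminorms. If a \<le> b, the error is at most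
  b/4, so the new a is at most b/2 and the new b at least 15b/4. The spare factor 2 in the first
  claim is needed in \<open>unstable_cone\<close>.\<close>

lemma cone_step:
  assumes "1 \<le> \<tau>" "sta_seminorm \<tau> x \<le> unst_seminorm \<tau> x"
  shows "sta_seminorm (ratio * \<tau>) (U (ratio * \<tau>) \<tau> x) \<le> unst_seminorm (ratio * \<tau>) (U (ratio * \<tau>) \<tau> x) / 2"
    and "2 * unst_seminorm \<tau> x \<le> unst_seminorm (ratio * \<tau>) (U (ratio * \<tau>) \<tau> x)"
  using sta_U_ratio[OF assms(1), of x] unst_U_ratio[OF assms(1), of x] assms(2)
    seminorm_nonneg[OF seminorm_sta[OF assms(1)], of x]
  unfolding adapted_def add_divide_distrib by (-, linarith+)

lemma cone_iterate:
  assumes "1 \<le> \<tau>" "sta_seminorm \<tau> x \<le> unst_seminorm \<tau> x"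
  shows "sta_seminorm (ratio ^ n * \<tau>) (U (ratio ^ n * \<tau>) \<tau> x) \<le> unst_seminorm (ratio ^ n * \<tau>) (U (ratio ^ n * \<tau>) \<tau> x)
    \<and> 2 ^ n * unst_seminorm \<tau> x \<le> unst_seminorm (ratio ^ n * \<tau>) (U (ratio ^ n * \<tau>) \<tau> x)"
proof (induction n)
  case 0
  then show ?case using assms by (simp add: evolution_family_refl[OF evolU])
next
  case (Suc n)
  note t = ratio_power_mult(1)[OF assms(1), of n]
  have e: "ratio ^ Suc n * \<tau> = ratio * (ratio ^ n * \<tau>)" by (simp add: mult.assoc)
  show ?case
    unfolding U_ratio_Suc[OF assms(1)] unfolding e
    using cone_step[OF t, of "U (ratio ^ n * \<tau>) \<tau> x"] Suc.IH
      seminorm_nonneg[OF seminorm_sta[OF t], of "U (ratio ^ n * \<tau>) \<tau> x"] by simp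
qed

text \<open>The constant 4 has two sources: a factor 2 from rounding \<open>t / \<tau>\<close> up to
  a power of \<open>ratio\<close>, and a factor 2 for the possible loss over the last, incomplete
  step.\<close>

lemma cone_expand:
  assumes "1 \<le> \<tau>" "\<tau> \<le> t" "sta_seminorm \<tau> x \<le> unst_seminorm \<tau> x"
  shows "(t / \<tau>) powr (lam / 2) * unst_seminorm \<tau> x \<le> 4 * unst_seminorm t (U t \<tau> x)"
proof -
  obtain n where n: "ratio ^ n * \<tau> \<le> t" "t < ratio ^ Suc n * \<tau>"
    using ex_geometric_interval[OF ratio_gt_1 _ assms(2)] assms(1) by auto
  define s where "s = ratio ^ n * \<tau>"
  have s: "1 \<le> s" "\<tau> \<le> s" "s \<le> t" "t \<le> ratio * s"
    using ratio_power_mult[OF assms(1), of n] n by (simp_all add: s_def mult.assoc)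
  have "(t / \<tau>) powr (lam / 2) \<le> (ratio ^ Suc n) powr (lam / 2)"
    using n assms lam_pos by (intro powr_mono2) (auto simp: field_simps)
  then have "(t / \<tau>) powr (lam / 2) * unst_seminorm \<tau> x \<le> 2 * (2 ^ n * unst_seminorm \<tau> x)"
    unfolding ratio_power_half using seminorm_nonneg[OF seminorm_unst[OF assms(1)], of x]
    by (metis mult.assoc mult_right_mono power_Suc)
  moreover have "unst_seminorm s (U s \<tau> x) \<le> 2 * unst_seminorm t (U t \<tau> x)"
    using unst_U_ge[OF s(1,3,4), of "U s \<tau> x"] cone_iterate[OF assms(1,3), of n]
      seminorm_nonneg[OF seminorm_unst, of t "U t \<tau> x", OF order_trans[OF s(1,3)]]
    unfolding adapted_def add_divide_distrib compU[OF s(2,3) assms(1)] s_def[symmetric] by linarith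
  ultimately show ?thesis
    using cone_iterate[OF assms(1,3), of n] unfolding s_def by linarith
qed

section \<open>Stable and unstable spaces of \<open>U\<close>\<close>

definition stable_space :: "real \<Rightarrow> 'a set" where
  "stable_space \<tau> = {x. \<exists>R. \<forall>t\<ge>\<tau>. adapted t (U t \<tau> x) \<le> R}"

text \<open>\<open>U\<close> is not known to be invertible, so the space is pushed forward from time
  1. This makes it invariant by construction.\<close>

definition unstable_space :: "real \<Rightarrow> 'a set" where
  "unstable_space \<tau> = U \<tau> 1 ` kerP (P 1)"

lemma subspace_stable:
  assumes "1 \<le> \<tau>"
  shows "subspace (stable_space \<tau>)"
proof (rule subspaceI)
  have N: "seminorm (adapted t)" if "\<tau> \<le> t" for t using that assms by (intro seminorm_adapted) simp
  show "0 \<in> stable_space \<tau>"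
    by (auto simp: stable_space_def seminorm_zero[OF N] intro!: exI[of _ 0])
  show "x + y \<in> stable_space \<tau>" if xy: "x \<in> stable_space \<tau>" "y \<in> stable_space \<tau>" for x y
  proof -
    obtain R S where RS: "\<And>t. \<tau> \<le> t \<Longrightarrow> adapted t (U t \<tau> x) \<le> R" "\<And>t. \<tau> \<le> t \<Longrightarrow> adapted t (U t \<tau> y) \<le> S"
      using xy by (auto simp: stable_space_def)
    have "adapted t (U t \<tau> (x + y)) \<le> R + S" if "\<tau> \<le> t" for t
      using RS[OF that] seminorm_triangle[OF N[OF that], of "U t \<tau> x" "U t \<tau> y"]
      by (simp add: blinfun.add_right)
    then show ?thesis by (auto simp: stable_space_def)
  qed
  show "r *\<^sub>R x \<in> stable_space \<tau>" if x: "x \<in> stable_space \<tau>" for r x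
  proof -
    obtain R where R: "\<And>t. \<tau> \<le> t \<Longrightarrow> adapted t (U t \<tau> x) \<le> R"
      using x by (auto simp: stable_space_def)
    have "adapted t (U t \<tau> (r *\<^sub>R x)) \<le> \<bar>r\<bar> * R" if "\<tau> \<le> t" for t
      using mult_left_mono[OF R[OF that], of "\<bar>r\<bar>"]
      by (simp add: blinfun.scaleR_right seminorm_scaleR[OF N[OF that]])
    then show ?thesis by (auto simp: stable_space_def)
  qed
qed

lemma subspace_unstable: "subspace (unstable_space \<tau>)"
proof -
  have "subspace (kerP (P 1))"
    by (rule subspaceI) (simp_all add: kerP_def blinfun.bilinear_simps)
  then show ?thesis unfolding unstable_space_def
    by (intro linear_subspace_image bounded_linear.linear blinfun.bounded_linear_right)
qed

lemma stable_invariant: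
  assumes "1 \<le> \<tau>" "\<tau> \<le> t" "x \<in> stable_space \<tau>"
  shows "U t \<tau> x \<in> stable_space t"
  using assms(3) compU[OF assms(2) _ assms(1), of _ x] order_trans[OF assms(2)]
  unfolding stable_space_def by fastforce

lemma unstable_invariant:
  assumes "1 \<le> \<tau>" "\<tau> \<le> t"
  shows "U t \<tau> ` unstable_space \<tau> = unstable_space t"
  using compU[OF assms order_refl] by (simp add: unstable_space_def image_image)

text \<open>Otherwise the vector lies in the unstable cone, where \<open>unst_seminorm\<close>
  doubles at every step, contradicting boundedness of the orbit.\<close>

lemma stable_cone:
  assumes "1 \<le> \<tau>" "x \<in> stable_space \<tau>"
  shows "unst_seminorm \<tau> x \<le> sta_seminorm \<tau> x"
proof (rule ccontr)
  assume *: "\<not> ?thesis"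
  then have pos: "0 < unst_seminorm \<tau> x"
    using seminorm_nonneg[OF seminorm_sta[OF assms(1)], of x] by linarith
  obtain R where R: "\<And>t. \<tau> \<le> t \<Longrightarrow> adapted t (U t \<tau> x) \<le> R"
    using assms(2) by (auto simp: stable_space_def)
  obtain n where n: "R / unst_seminorm \<tau> x < 2 ^ n" using real_arch_pow[of 2] by auto
  then have "R < 2 ^ n * unst_seminorm \<tau> x" using pos by (simp add: field_simps)
  also have "\<dots> \<le> unst_seminorm (ratio ^ n * \<tau>) (U (ratio ^ n * \<tau>) \<tau> x)"
    using cone_iterate[OF assms(1), of x n] * by simp
  also have "\<dots> \<le> R"
    using unst_le_adapted[OF ratio_power_mult(1)[OF assms(1), of n]] R[OF ratio_power_mult(2)[OF assms(1), of n]]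
    by (rule order_trans)
  finally show False by simp
qed

text \<open>The orbit stays in the stable space, hence in the cone of \<open>stable_cone\<close>.
  There the adapted norm is at most twice the stable seminorm a, so one step gives at most a/4 +
  a/4.\<close>

lemma stable_iterate:
  assumes "1 \<le> \<tau>" "x \<in> stable_space \<tau>"
  shows "2 ^ n * sta_seminorm (ratio ^ n * \<tau>) (U (ratio ^ n * \<tau>) \<tau> x) \<le> sta_seminorm \<tau> x"
proof (induction n)
  case 0
  then show ?case using assms by (simp add: evolution_family_refl[OF evolU])
next
  case (Suc n)
  note t = ratio_power_mult[OF assms(1), of n]
  let ?y = "U (ratio ^ n * \<tau>) \<tau> x"
  have e: "ratio ^ Suc n * \<tau> = ratio * (ratio ^ n * \<tau>)" by (simp add: mult.assoc)
  have "sta_seminorm (ratio ^ Suc n * \<tau>) (U (ratio ^ Suc n * \<tau>) \<tau> x) \<le> sta_seminorm (ratio ^ n * \<tau>) ?y / 2"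
    using sta_U_ratio[OF t(1), of ?y] stable_cone[OF t(1) stable_invariant[OF assms(1) t(2) assms(2)]]
    unfolding U_ratio_Suc[OF assms(1)] unfolding e adapted_def add_divide_distrib by linarith
  then have "2 ^ Suc n * sta_seminorm (ratio ^ Suc n * \<tau>) (U (ratio ^ Suc n * \<tau>) \<tau> x)
      \<le> 2 ^ Suc n * (sta_seminorm (ratio ^ n * \<tau>) ?y / 2)"
    by (intro mult_left_mono) auto
  also have "\<dots> = 2 ^ n * sta_seminorm (ratio ^ n * \<tau>) ?y" by simp
  finally show ?case using Suc.IH by linarith
qed

text \<open>The constant 8 collects three factors 2: rounding to powers of \<open>ratio\<close>, the
  incomplete last step, and the passage from \<open>sta_seminorm\<close> to \<open>adapted\<close>
  inside the cone.\<close>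

lemma stable_contract:
  assumes "1 \<le> \<tau>" "\<tau> \<le> t" "x \<in> stable_space \<tau>"
  shows "adapted t (U t \<tau> x) \<le> 8 * (t / \<tau>) powr (- (lam / 2)) * adapted \<tau> x"
proof -
  obtain n where n: "ratio ^ n * \<tau> \<le> t" "t < ratio ^ Suc n * \<tau>"
    using ex_geometric_interval[OF ratio_gt_1 _ assms(2)] assms(1) by auto
  define s where "s = ratio ^ n * \<tau>"
  have s: "1 \<le> s" "\<tau> \<le> s" "s \<le> t" "t \<le> ratio * s" "1 \<le> t"
    using ratio_power_mult[OF assms(1), of n] n by (simp_all add: s_def mult.assoc)
  let ?p = "(t / \<tau>) powr (lam / 2)"
  have p: "0 < ?p" using assms by simp
  have "?p \<le> (ratio ^ Suc n) powr (lam / 2)"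
    using n assms lam_pos by (intro powr_mono2) (auto simp: field_simps)
  then have p2: "?p \<le> 2 ^ Suc n" unfolding ratio_power_half .
  have cone_s: "unst_seminorm s (U s \<tau> x) \<le> sta_seminorm s (U s \<tau> x)"
    by (rule stable_cone[OF s(1) stable_invariant[OF assms(1) s(2) assms(3)]])
  have cone_t: "unst_seminorm t (U t \<tau> x) \<le> sta_seminorm t (U t \<tau> x)"
    by (rule stable_cone[OF s(5) stable_invariant[OF assms]])
  have "sta_seminorm t (U t \<tau> x) \<le> 2 * sta_seminorm s (U s \<tau> x)"
    using sta_U_le[OF s(1,3,4), of "U s \<tau> x"] cone_s
      seminorm_nonneg[OF seminorm_sta[OF s(1)], of "U s \<tau> x"]
    unfolding adapted_def add_divide_distrib compU[OF s(2,3) assms(1)] by linarith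
  then have "adapted t (U t \<tau> x) \<le> 4 * sta_seminorm s (U s \<tau> x)"
    using cone_t by (simp add: adapted_def)
  then have "?p * adapted t (U t \<tau> x) \<le> 2 ^ Suc n * (4 * sta_seminorm s (U s \<tau> x))"
    using p2 seminorm_nonneg[OF seminorm_adapted[OF s(5)]] by (intro mult_mono) auto
  also have "\<dots> \<le> 8 * sta_seminorm \<tau> x"
    using stable_iterate[OF assms(1,3), of n] by (simp add: s_def)
  also have "\<dots> \<le> 8 * adapted \<tau> x" using sta_le_adapted[OF assms(1), of x] by simp
  finally show ?thesis using p by (simp add: powr_minus field_simps)
qed

text \<open>At grid times the orbit satisfies a \<le> b/2: \<open>cone_step\<close> gives this after
  a full step, and a = 0 gives it at time 1. The slack survives the final incomplete step, after
  which a is at most 11/16 and b at least 13/16 of the earlier b.\<close>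

lemma unstable_cone:
  assumes "1 \<le> \<tau>" "x \<in> unstable_space \<tau>"
  shows "sta_seminorm \<tau> x \<le> unst_seminorm \<tau> x"
proof -
  obtain y where y: "P 1 y = 0" "x = U \<tau> 1 y"
    using assms(2) by (auto simp: unstable_space_def kerP_def)
  have y0: "sta_seminorm 1 y = 0" using y(1) by (simp add: sta_zero_of_ker)
  then have y1: "sta_seminorm 1 y \<le> unst_seminorm 1 y" by (simp add: seminorm_nonneg[OF seminorm_unst])
  obtain n where n: "ratio ^ n \<le> \<tau>" "\<tau> < ratio ^ Suc n"
    using ex_geometric_interval[OF ratio_gt_1 _ assms(1)] by auto
  define s where "s = ratio ^ n"
  have s: "1 \<le> s" "s \<le> \<tau>" "\<tau> \<le> ratio * s"
    using one_le_ratio_power[of n] n by (simp_all add: s_def)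
  let ?z = "U s 1 y"
  have "sta_seminorm s ?z \<le> unst_seminorm s ?z / 2"
  proof (cases n)
    case 0
    then show ?thesis using y0 by (simp add: s_def evolution_family_refl[OF evolU] seminorm_nonneg[OF seminorm_unst])
  next
    case (Suc k)
    then have "s = ratio * ratio ^ k" by (simp add: s_def)
    then show ?thesis
      using cone_step(1)[OF one_le_ratio_power[of k], of "U (ratio ^ k) 1 y"] cone_iterate[OF order_refl y1, of k]
        U_ratio_Suc[of 1 k y] by simp
  qed
  then show ?thesis
    using sta_U_le[OF s, of ?z] unst_U_ge[OF s, of ?z] seminorm_nonneg[OF seminorm_sta[OF s(1)], of ?z]
    unfolding adapted_def add_divide_distrib y(2) compU[OF s(1,2) order_refl] by linarith
qed

text \<open>In the unstable cone \<open>unst_seminorm\<close> doubles at each step; a bounded orbit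
  forces it to vanish, and the cone condition then makes \<open>sta_seminorm\<close> vanish
  too.\<close>

lemma stable_Int_unstable:
  assumes "1 \<le> \<tau>"
  shows "stable_space \<tau> \<inter> unstable_space \<tau> = {0}"
proof -
  have "x = 0" if x: "x \<in> stable_space \<tau>" "x \<in> unstable_space \<tau>" for x
  proof -
    note c = unstable_cone[OF assms x(2)]
    obtain R where R: "\<And>t. \<tau> \<le> t \<Longrightarrow> adapted t (U t \<tau> x) \<le> R"
      using x(1) by (auto simp: stable_space_def)
    have "2 ^ n * unst_seminorm \<tau> x \<le> R" for n
      using cone_iterate[OF assms c, of n] R[OF ratio_power_mult(2)[OF assms, of n]]
        unst_le_adapted[OF ratio_power_mult(1)[OF assms, of n], of "U (ratio ^ n * \<tau>) \<tau> x"] by linarith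
    moreover obtain n where "R / unst_seminorm \<tau> x < 2 ^ n" using real_arch_pow[of 2] by auto
    ultimately have "\<not> 0 < unst_seminorm \<tau> x"
      by (metis linorder_not_le pos_divide_less_eq)
    then have "norm x \<le> 0" using c norm_le_adapted[OF assms, of x] by linarith
    then show "x = 0" by simp
  qed
  then show ?thesis
    using subspace_0[OF subspace_stable[OF assms]] subspace_0[OF subspace_unstable[of \<tau>]] by auto
qed

text \<open>A sequence with \<open>z (n+1) = U z n + g (n+1)\<close> and \<open>P 1 (z 0) = 0\<close> is a fixed point of the map that
  determines the stable component of \<open>z n\<close> from \<open>z (n-1)\<close> and the unstable one from \<open>z (n+1)\<close>. In the
  adapted norms this map is a contraction, so \<open>z\<close> is given by a Neumann series.\<close>

definition shift :: "(nat \<Rightarrow> 'a) \<Rightarrow> nat \<Rightarrow> 'a" where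
  "shift z n = (case n of 0 \<Rightarrow> 0 | Suc k \<Rightarrow> P (ratio ^ n) (U (ratio ^ n) (ratio ^ k) (z k)))
     + pullback (ratio ^ n) (ratio ^ Suc n)
         (z (Suc n) - (U (ratio ^ Suc n) (ratio ^ n) (z n) - T (ratio ^ Suc n) (ratio ^ n) (z n)))"

section \<open>Bounded solutions on the geometric grid\<close>

lemma grid: "1 \<le> ratio ^ n" "ratio ^ n \<le> ratio ^ Suc n" "ratio ^ Suc n \<le> ratio * ratio ^ n"
  using one_le_ratio_power[of n] ratio_mult_ge[OF one_le_ratio_power[of n]] by auto

lemma sta_proj:
  assumes "1 \<le> t"
  shows "sta_seminorm t (P t x) = sta_seminorm t x"
  using sta_diff_proj[OF assms, of x] seminorm_minus_commute[OF seminorm_sta[OF assms], of x "P t x"]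
  by (intro seminorm_eqI[OF seminorm_sta[OF assms]]) simp

lemma sta_pullback: "1 \<le> s \<Longrightarrow> s \<le> t \<Longrightarrow> sta_seminorm s (pullback s t x) = 0"
  using pullback_in_ker[of s t x] by (intro sta_zero_of_ker) (simp_all add: kerP_def)

lemma unst_pullback_grid:
  "unst_seminorm (ratio ^ n) (pullback (ratio ^ n) (ratio ^ Suc n) x) \<le> unst_seminorm (ratio ^ Suc n) x / 4"
  using unst_pullback[OF grid(2,1), of n x] grid(1)[of n] ratio_gt_1
  by (simp add: powr_minus ratio_powr_lam)

text \<open>The two summands of \<open>shift\<close> have only a stable and only an unstable part,
  respectively. The first is at most (1/4 + 1/8)e, the second at most (1 + 1/8)e/4, and both are
  below 3e/8.\<close>

lemma shift_bound:
  assumes e: "\<And>n. adapted (ratio ^ n) (z n) \<le> e"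
  shows "adapted (ratio ^ n) (shift z n) \<le> 3 / 4 * e"
proof -
  define p where "p = (case n of 0 \<Rightarrow> 0 | Suc k \<Rightarrow> P (ratio ^ n) (U (ratio ^ n) (ratio ^ k) (z k)))"
  define v where "v = U (ratio ^ Suc n) (ratio ^ n) (z n) - T (ratio ^ Suc n) (ratio ^ n) (z n)"
  define w where "w = pullback (ratio ^ n) (ratio ^ Suc n) (z (Suc n) - v)"
  have e0: "0 \<le> e" using seminorm_nonneg[OF seminorm_adapted[OF grid(1)]] e order_trans by blast
  have 1: "sta_seminorm (ratio ^ n) p \<le> 3 / 8 * e \<and> unst_seminorm (ratio ^ n) p = 0"
  proof (cases n)
    case 0
    then show ?thesis
      using e0 by (simp add: p_def seminorm_zero[OF seminorm_sta] seminorm_zero[OF seminorm_unst])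
  next
    case (Suc k)
    have p: "p = P (ratio ^ n) (U (ratio ^ n) (ratio ^ k) (z k))" by (simp add: p_def Suc)
    have "sta_seminorm (ratio ^ n) p = sta_seminorm (ratio ^ n) (U (ratio ^ n) (ratio ^ k) (z k))"
      unfolding p by (rule sta_proj[OF grid(1)])
    also have "\<dots> \<le> sta_seminorm (ratio ^ k) (z k) / 4 + adapted (ratio ^ k) (z k) / 8"
      using sta_U_ratio[OF grid(1)[of k], of "z k"] by (simp add: Suc)
    also have "\<dots> \<le> 3 / 8 * e"
      using e[of k] sta_le_adapted[OF grid(1)[of k], of "z k"] by simp
    finally show ?thesis unfolding p using unst_seminorm_proj[OF grid(1)] by simp
  qed
  have "unst_seminorm (ratio ^ n) w \<le> unst_seminorm (ratio ^ Suc n) (z (Suc n) - v) / 4"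
    unfolding w_def by (rule unst_pullback_grid)
  also have "\<dots> \<le> 3 / 8 * e"
    using seminorm_diff_le[OF seminorm_unst[OF grid(1)[of "Suc n"]], of "z (Suc n)" v]
      unst_le_adapted[OF grid(1)[of "Suc n"], of "z (Suc n)"] e[of "Suc n"]
      unst_le_adapted[OF grid(1)[of "Suc n"], of v] close[OF grid, of n "z n"] e[of n] e0
    unfolding v_def[symmetric] by linarith
  finally have 2: "unst_seminorm (ratio ^ n) w \<le> 3 / 8 * e" .
  have 3: "sta_seminorm (ratio ^ n) w = 0"
    unfolding w_def by (rule sta_pullback[OF grid(1,2)])
  have "shift z n = p + w" by (simp add: shift_def p_def w_def v_def)
  then show ?thesis
    using seminorm_triangle[OF seminorm_adapted[OF grid(1)[of n]], of p w] 1 2 3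
    unfolding adapted_def by simp
qed

lemma ex_bounded_solution:
  assumes g0: "g 0 = 0" and g: "\<And>n. adapted (ratio ^ n) (g n) \<le> R"
  shows "\<exists>z. P 1 (z 0) = 0 \<and> (\<forall>n. z (Suc n) = U (ratio ^ Suc n) (ratio ^ n) (z n) + g (Suc n))
    \<and> (\<forall>n. adapted (ratio ^ n) (z n) \<le> 8 * R)"
proof -
  \<comment> \<open>Inhomogeneous part of the fixed point equation: \<open>g n\<close> enters the
    stable component forwards, \<open>g (Suc n)\<close> the unstable one backwards and hence with a
    minus sign.\<close>
  define h where "h = (\<lambda>n. P (ratio ^ n) (g n) - pullback (ratio ^ n) (ratio ^ Suc n) (g (Suc n)))"
  define d where "d = (\<lambda>k. (shift ^^ k) h)"
  have bl: "bounded_linear (pullback (ratio ^ n) (ratio ^ Suc n))" for n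
    by (rule pullback_bounded_linear[OF grid(2,1)])
  have h: "adapted (ratio ^ n) (h n) \<le> 2 * R" for n
  proof -
    note N = seminorm_adapted[OF grid(1)[of n]]
    have "adapted (ratio ^ n) (P (ratio ^ n) (g n)) \<le> R"
      using sta_le_adapted[OF grid(1)[of n], of "g n"] g[of n]
      by (simp add: adapted_def sta_proj[OF grid(1)] unst_seminorm_proj[OF grid(1)])
    moreover have "adapted (ratio ^ n) (pullback (ratio ^ n) (ratio ^ Suc n) (g (Suc n))) \<le> R"
      using unst_le_adapted[OF grid(1)[of "Suc n"], of "g (Suc n)"] g[of "Suc n"]
        unst_pullback_grid[of n "g (Suc n)"] sta_pullback[OF grid(1,2), of n "g (Suc n)"]
        seminorm_nonneg[OF seminorm_unst[OF grid(1)[of "Suc n"]], of "g (Suc n)"]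
      unfolding adapted_def by linarith
    ultimately show ?thesis
      using seminorm_diff_le[OF N, of "P (ratio ^ n) (g n)" "pullback (ratio ^ n) (ratio ^ Suc n) (g (Suc n))"]
      unfolding h_def by linarith
  qed
  have d: "adapted (ratio ^ n) (d k n) \<le> (3 / 4) ^ k * (2 * R)" for k n
  proof (induction k arbitrary: n)
    case 0
    then show ?case using h by (simp add: d_def)
  next
    case (Suc k)
    then show ?case using shift_bound[of "d k" "(3 / 4) ^ k * (2 * R)" n] by (simp add: d_def mult_ac)
  qed
  have e: "(\<lambda>k. (3 / 4) ^ k * (2 * R)) sums (8 * R)"
    using sums_mult2[OF geometric_sums[of "3 / 4 :: real"], of "2 * R"] by simp
  have "summable (\<lambda>k. d k n)" for n
  proof (rule summable_comparison_test[OF _ sums_summable[OF e]])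
    have "norm (d k n) \<le> (3 / 4) ^ k * (2 * R)" for k
      using norm_le_adapted[OF grid(1)[of n], of "d k n"] d[of n k] by (simp add: adapted_def)
    then show "\<exists>N. \<forall>k\<ge>N. norm (d k n) \<le> (3 / 4) ^ k * (2 * R)" by blast
  qed
  then obtain z where z: "\<And>n. (\<lambda>k. d k n) sums z n" using summable_sums by meson
  have "(\<lambda>k. shift (d k) n) sums shift z n" for n
  proof -
    have "(\<lambda>k. case n of 0 \<Rightarrow> 0 | Suc m \<Rightarrow> P (ratio ^ n) (U (ratio ^ n) (ratio ^ m) (d k m))) sums
        (case n of 0 \<Rightarrow> 0 | Suc m \<Rightarrow> P (ratio ^ n) (U (ratio ^ n) (ratio ^ m) (z m)))"
      by (cases n) (auto intro!: bounded_linear.sums[OF blinfun.bounded_linear_right] z)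
    then show ?thesis unfolding shift_def
      by (intro sums_add bounded_linear.sums[OF bl] sums_diff z
            bounded_linear.sums[OF blinfun.bounded_linear_right])
  qed
  then have "(\<lambda>k. d (Suc k) n) sums shift z n" for n by (simp add: d_def)
  \<comment> \<open>Restoring the term \<open>d 0 = h\<close> of the Neumann series yields the fixed
    point equation.\<close>
  from sums_Suc[OF this] have fp: "z n = shift z n + h n" for n
    using sums_unique2[OF z] by (simp add: d_def)
  have ker: "P (ratio ^ n) (pullback (ratio ^ n) (ratio ^ Suc n) x) = 0" for n x
    using pullback_in_ker[OF grid(2,1), of n x] by (simp add: kerP_def)
  \<comment> \<open>The stable half of the recursion: the projection annihilates the pulled back
    summand of \<open>z (Suc n)\<close>.\<close>
  have Pz: "P (ratio ^ Suc n) (z (Suc n)) = P (ratio ^ Suc n) (U (ratio ^ Suc n) (ratio ^ n) (z n) + g (Suc n))" for n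
    by (subst fp) (simp add: shift_def h_def blinfun.bilinear_simps proj_idem[OF grid(1)[of "Suc n", simplified]]
        ker[of "Suc n", simplified])
  have "P 1 (z 0) = 0"
    using ker[of 0] by (subst fp) (simp add: shift_def h_def blinfun.bilinear_simps g0)
  moreover have "z (Suc n) = U (ratio ^ Suc n) (ratio ^ n) (z n) + g (Suc n)" for n
  proof -
    define A where "A = T (ratio ^ Suc n) (ratio ^ n)"
    \<comment> \<open>The unstable half: \<open>A (z n) - y\<close> is the residual of the
      recursion. It is shown to lie in the range of \<open>P (ratio ^ Suc n)\<close>, and by
      \<open>Pz\<close> that projection maps it to 0.\<close>
    define y where "y = z (Suc n) - (U (ratio ^ Suc n) (ratio ^ n) (z n) - A (z n)) - g (Suc n)"
    define u where "u = z n - pullback (ratio ^ n) (ratio ^ Suc n) y"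
    have "\<exists>v. u = P (ratio ^ n) v"
    proof -
      have "u = (case n of 0 \<Rightarrow> 0 | Suc k \<Rightarrow> P (ratio ^ n) (U (ratio ^ n) (ratio ^ k) (z k))) + P (ratio ^ n) (g n)"
        unfolding u_def y_def A_def
        by (subst fp) (simp add: shift_def h_def linear_diff[OF bounded_linear.linear[OF bl]] del: power_Suc)
      then show ?thesis
        by (cases n) (auto simp: g0 simp flip: blinfun.add_right intro: exI[of _ 0])
    qed
    then have "P (ratio ^ n) u = u" using proj_idem[OF grid(1)] by auto
    then have "P (ratio ^ Suc n) (A u) = A u"
      using proj_commute[OF grid(2,1), of n u] by (simp add: A_def)
    moreover have "A u = A (z n) - (y - P (ratio ^ Suc n) y)"
      using apply_pullback[OF grid(2,1), of n y] by (simp add: A_def u_def blinfun.diff_right)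
    ultimately have "A (z n) - y = P (ratio ^ Suc n) (A (z n) - y)"
      by (simp add: blinfun.bilinear_simps proj_idem[OF grid(1)] del: power_Suc)
    then show ?thesis
      using Pz[of n] by (simp add: y_def blinfun.bilinear_simps del: power_Suc)
  qed
  moreover have "adapted (ratio ^ n) (z n) \<le> 8 * R" for n
  proof (rule seminorm_suminf_le[OF seminorm_adapted[OF grid(1)] _ z d e])
    show "adapted (ratio ^ n) x \<le> (K + 2 * D) * (ratio ^ n) powr eps * norm x" for x
      using adapted_le_norm[OF grid(1)] by (simp add: adapted_def)
  qed
  ultimately show ?thesis by blast
qed

section \<open>Splitting into stable and unstable vectors\<close>

definition proj_growth :: real where
  "proj_growth = 1 + 8 * step_growth * step_growth"

text \<open>The vector \<open>x\<close>, transported to the next grid time, is injected into a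
  bounded solution \<open>z\<close>. Before the injection \<open>z\<close> is a
  \<open>U\<close>-orbit from the kernel of \<open>P 1\<close>, which supplies \<open>f\<close> at
  \<open>\<tau>\<close>; afterwards it continues the orbit of \<open>x + f\<close>. In
  \<open>proj_growth\<close> one \<open>step_growth\<close> carries \<open>x\<close> to the grid,
  the other carries \<open>z m\<close> to \<open>\<tau>\<close>, and 8 is the constant of
  \<open>ex_bounded_solution\<close>.\<close>

lemma ex_decomposition:
  assumes \<tau>: "1 \<le> \<tau>"
  shows "\<exists>e\<in>stable_space \<tau>. x - e \<in> unstable_space \<tau> \<and> adapted \<tau> e \<le> proj_growth * adapted \<tau> x"
proof -
  obtain m where m: "ratio ^ m \<le> \<tau>" "\<tau> < ratio ^ Suc m"
    using ex_geometric_interval[OF ratio_gt_1 _ \<tau>] by auto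
  have m': "\<tau> \<le> ratio * ratio ^ m" using m by simp
  have m'': "ratio ^ Suc m \<le> ratio * \<tau>" using m ratio_gt_1 by simp
  define R where "R = step_growth * adapted \<tau> x"
  define g where "g = (\<lambda>n. if n = Suc m then U (ratio ^ Suc m) \<tau> x else 0)"
  have R0: "0 \<le> R"
    using seminorm_nonneg[OF seminorm_adapted[OF \<tau>]] step_growth_gt_1 by (simp add: R_def)
  have "adapted (ratio ^ n) (g n) \<le> R" for n
    using adapted_U[OF \<tau> _ m'', of x] m R0 seminorm_zero[OF seminorm_adapted[OF grid(1)[of n]]]
    by (auto simp: g_def R_def)
  moreover have "g 0 = 0" by (simp add: g_def)
  ultimately obtain z where z: "P 1 (z 0) = 0
      \<and> (\<forall>n. z (Suc n) = U (ratio ^ Suc n) (ratio ^ n) (z n) + g (Suc n))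
      \<and> (\<forall>n. adapted (ratio ^ n) (z n) \<le> 8 * R)"
    using ex_bounded_solution[of g R] by auto
  note z0 = conjunct1[OF z] and zS = conjunct1[OF conjunct2[OF z], rule_format]
    and zN = conjunct2[OF conjunct2[OF z], rule_format]
  have zm: "n \<le> m \<Longrightarrow> z n = U (ratio ^ n) 1 (z 0)" for n
  proof (induction n)
    case 0
    then show ?case by (simp add: evolution_family_refl[OF evolU])
  next
    case (Suc n)
    have "z (Suc n) = U (ratio ^ Suc n) (ratio ^ n) (z n)"
      using zS[of n] Suc.prems by (simp add: g_def del: power_Suc)
    also have "\<dots> = U (ratio ^ Suc n) 1 (z 0)"
      using Suc compU[OF grid(1,2) order_refl, of n "z 0"] by simp
    finally show ?case .
  qed
  define f where "f = U \<tau> (ratio ^ m) (z m)"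
  have "f = U \<tau> 1 (z 0)"
    unfolding f_def zm[OF order_refl] by (rule compU[OF grid(1) m(1) order_refl])
  then have f: "f \<in> unstable_space \<tau>" using z0 by (simp add: unstable_space_def kerP_def)
  have "adapted \<tau> f \<le> step_growth * adapted (ratio ^ m) (z m)"
    unfolding f_def by (rule adapted_U[OF grid(1) m(1) m'])
  also have "\<dots> \<le> step_growth * (8 * R)"
    using zN[of m] step_growth_gt_1 by (intro mult_left_mono) auto
  finally have "adapted \<tau> (x + f) \<le> proj_growth * adapted \<tau> x"
    using seminorm_triangle[OF seminorm_adapted[OF \<tau>], of x f]
    by (simp add: proj_growth_def R_def algebra_simps)
  moreover have "x - (x + f) \<in> unstable_space \<tau>"
    using subspace_neg[OF subspace_unstable f] by simp
  moreover have "x + f \<in> stable_space \<tau>"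
  proof -
    have ge: "\<tau> \<le> ratio ^ (Suc m + j)" for j
    proof -
      have "ratio ^ Suc m \<le> ratio ^ (Suc m + j)"
        using ratio_gt_1 by (intro power_increasing) auto
      then show ?thesis using m(2) by linarith
    qed
    \<comment> \<open>At \<open>ratio ^ Suc m\<close> the orbit of \<open>f\<close> contributes
      \<open>U\<close> applied to \<open>z m\<close>, and that of \<open>x\<close> contributes the
      injected term.\<close>
    have orbit: "U (ratio ^ (Suc m + j)) \<tau> (x + f) = z (Suc m + j)" for j
    proof (induction j)
      case 0
      have "U (ratio ^ Suc m) \<tau> f = U (ratio ^ Suc m) (ratio ^ m) (z m)"
        unfolding f_def using m by (intro compU grid) auto
      then show ?case using zS[of m] by (simp add: g_def blinfun.add_right del: power_Suc)
    next
      case (Suc j)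
      from compU[OF ge grid(2) \<tau>, of j "x + f"] show ?case
        using Suc zS[of "Suc m + j"] by (simp add: g_def del: power_Suc)
    qed
    \<comment> \<open>Bounds between grid times: before \<open>ratio ^ Suc m\<close> one step from
      \<open>\<tau>\<close> suffices, later one step from the preceding grid time.\<close>
    have "adapted t (U t \<tau> (x + f)) \<le> max (step_growth * adapted \<tau> (x + f)) (step_growth * (8 * R))"
      if t: "\<tau> \<le> t" for t
    proof (cases "t \<le> ratio ^ Suc m")
      case True
      then show ?thesis using adapted_U[OF \<tau> t, of "x + f"] m'' by simp
    next
      case False
      then obtain n where n: "ratio ^ n * ratio ^ Suc m \<le> t" "t < ratio ^ Suc n * ratio ^ Suc m"
        using ex_geometric_interval[OF ratio_gt_1, of "ratio ^ Suc m" t] ratio_gt_1 by auto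
      let ?s = "ratio ^ (Suc m + n)"
      have s: "?s \<le> t" "t \<le> ratio * ?s" "\<tau> \<le> ?s"
        using n ge[of n] by (simp_all add: power_add mult_ac)
      have "adapted t (U t ?s (z (Suc m + n))) \<le> step_growth * adapted ?s (z (Suc m + n))"
        by (rule adapted_U[OF grid(1) s(1,2)])
      also have "\<dots> \<le> step_growth * (8 * R)"
        using zN[of "Suc m + n"] step_growth_gt_1 by (intro mult_left_mono) auto
      finally show ?thesis using compU[OF s(3,1) \<tau>, of "x + f"] orbit[of n] by simp
    qed
    then show ?thesis unfolding stable_space_def by blast
  qed
  ultimately show ?thesis by blast
qed

lemma U_growth: "\<exists>K b. 0 < K \<and> 0 < b \<and> (\<forall>t \<tau>. t \<ge> \<tau> \<and> \<tau> \<ge> 1 \<longrightarrow>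
  norm (U t \<tau>) \<le> K * (t / \<tau>) powr b * \<tau> powr eps)"
proof -
  \<comment> \<open>This exponent makes \<open>(ratio ^ n) powr b\<close> equal to the accumulated
    growth \<open>step_growth ^ n\<close>.\<close>
  define b where "b = log ratio step_growth"
  define C where "C = K + 2 * D"
  have b: "0 < b" "ratio powr b = step_growth"
    using ratio_gt_1 step_growth_gt_1 by (simp_all add: b_def)
  have C: "0 < C" using K_pos D_pos by (simp add: C_def)
  have "norm (U t \<tau>) \<le> (step_growth * C) * (t / \<tau>) powr b * \<tau> powr eps" if t: "\<tau> \<le> t" "1 \<le> \<tau>" for t \<tau>
  proof (rule norm_blinfun_bound)
    fix x
    obtain n where n: "ratio ^ n * \<tau> \<le> t" "t < ratio ^ Suc n * \<tau>"
      using ex_geometric_interval[OF ratio_gt_1 _ t(1)] t by auto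
    define s where "s = ratio ^ n * \<tau>"
    have s: "1 \<le> s" "\<tau> \<le> s" "s \<le> t" "t \<le> ratio * s"
      using ratio_power_mult[OF t(2), of n] n by (simp_all add: s_def mult.assoc)
    have N0: "0 \<le> adapted \<tau> x" by (rule seminorm_nonneg[OF seminorm_adapted[OF t(2)]])
    have it: "adapted (ratio ^ k * \<tau>) (U (ratio ^ k * \<tau>) \<tau> x) \<le> step_growth ^ k * adapted \<tau> x" for k
    proof (induction k)
      case 0
      then show ?case using t by (simp add: evolution_family_refl[OF evolU])
    next
      case (Suc k)
      have "adapted (ratio ^ Suc k * \<tau>) (U (ratio ^ Suc k * \<tau>) \<tau> x)
          \<le> step_growth * adapted (ratio ^ k * \<tau>) (U (ratio ^ k * \<tau>) \<tau> x)"
        using adapted_U[OF ratio_power_mult(1)[OF t(2), of k] ratio_mult_ge[OF ratio_power_mult(1)[OF t(2), of k]]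
          order_refl, of "U (ratio ^ k * \<tau>) \<tau> x"] U_ratio_Suc[OF t(2), of k x]
        by (simp add: mult.assoc)
      also have "\<dots> \<le> step_growth * (step_growth ^ k * adapted \<tau> x)"
        using Suc step_growth_gt_1 by (intro mult_left_mono) auto
      finally show ?case by (simp add: mult.assoc)
    qed
    have "step_growth ^ n = (ratio ^ n) powr b" by (simp add: ratio_power_powr b)
    also have "\<dots> \<le> (t / \<tau>) powr b"
      using n t b one_le_ratio_power[of n] by (intro powr_mono2) (auto simp: field_simps)
    finally have sg: "step_growth ^ n \<le> (t / \<tau>) powr b" .
    have "norm (U t \<tau> x) \<le> adapted t (U t s (U s \<tau> x))"
      using norm_le_adapted[of t "U t \<tau> x"] t compU[OF s(2,3) t(2)] by (simp add: adapted_def)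
    also have "\<dots> \<le> step_growth * adapted s (U s \<tau> x)" by (rule adapted_U[OF s(1,3,4)])
    also have "\<dots> \<le> step_growth * (step_growth ^ n * adapted \<tau> x)"
      using it[of n] step_growth_gt_1 unfolding s_def by (intro mult_left_mono) auto
    also have "\<dots> \<le> step_growth * ((t / \<tau>) powr b * (C * \<tau> powr eps * norm x))"
      using adapted_le_norm[OF t(2), of x] sg N0 step_growth_gt_1
      by (intro mult_left_mono mult_mono) (auto simp: adapted_def C_def)
    finally show "norm (U t \<tau> x) \<le> step_growth * C * (t / \<tau>) powr b * \<tau> powr eps * norm x"
      by (simp add: mult_ac)
  qed (use C step_growth_gt_1 in simp)
  then show ?thesis
    using b C step_growth_gt_1 by (intro exI[of _ "step_growth * C"] exI[of _ b]) auto
qed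

section \<open>Dichotomy of \<open>U\<close> with halved exponent and the same
  \<open>eps\<close>\<close>

theorem strong_npd_close: "strong_npd_with U eps"
proof -
  define C where "C = K + 2 * D"
  \<comment> \<open>One constant for both bounds: the stable one needs \<open>proj_growth\<close>,
    the complementary projection \<open>1 + proj_growth\<close>.\<close>
  define D' where "D' = 8 * (1 + proj_growth) * C"
  have C: "0 < C" using K_pos D_pos by (simp add: C_def)
  have G: "0 < proj_growth" using step_growth_gt_1 by (simp add: proj_growth_def add_pos_pos)
  have Cn: "adapted s y \<le> C * s powr eps * norm y" if "1 \<le> s" for s y
    using adapted_le_norm[OF that] by (simp add: adapted_def C_def)
  have nN: "norm y \<le> adapted s y" if "1 \<le> s" for s y
    using norm_le_adapted[OF that] by (simp add: adapted_def)
  have "\<exists>P' :: 'a \<Rightarrow>\<^sub>L 'a. \<forall>x e. P' x = e \<longleftrightarrow> e \<in> stable_space \<tau> \<and> x - e \<in> unstable_space \<tau>"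
    if \<tau>: "1 \<le> \<tau>" for \<tau>
  proof (rule ex_bounded_projection[OF subspace_stable[OF \<tau>] subspace_unstable stable_Int_unstable[OF \<tau>]])
    fix x
    obtain e where e: "e \<in> stable_space \<tau>" "x - e \<in> unstable_space \<tau>" "adapted \<tau> e \<le> proj_growth * adapted \<tau> x"
      using ex_decomposition[OF \<tau>] by blast
    have "norm e \<le> proj_growth * (C * \<tau> powr eps * norm x)"
      using nN[OF \<tau>, of e] e(3) mult_left_mono[OF Cn[OF \<tau>, of x], of proj_growth] G by linarith
    then show "\<exists>e\<in>stable_space \<tau>. x - e \<in> unstable_space \<tau> \<and> norm e \<le> proj_growth * C * \<tau> powr eps * norm x"
      using e by (auto simp: mult.assoc)
  qed
  then obtain P' :: "real \<Rightarrow> ('a \<Rightarrow>\<^sub>L 'a)" where P':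
    "\<And>\<tau> x e. 1 \<le> \<tau> \<Longrightarrow> P' \<tau> x = e \<longleftrightarrow> e \<in> stable_space \<tau> \<and> x - e \<in> unstable_space \<tau>"
    by metis
  have P'E: "P' \<tau> x \<in> stable_space \<tau>" and P'F: "x - P' \<tau> x \<in> unstable_space \<tau>" if "1 \<le> \<tau>" for \<tau> x
    using P'[OF that, of x "P' \<tau> x"] by simp_all
  have ker: "kerP (P' \<tau>) = unstable_space \<tau>" if "1 \<le> \<tau>" for \<tau>
    using P'[OF that, of _ 0] subspace_0[OF subspace_stable[OF that]] by (auto simp: kerP_def)
  have P'N: "adapted \<tau> (P' \<tau> x) \<le> proj_growth * (C * \<tau> powr eps * norm x)" if \<tau>: "1 \<le> \<tau>" for \<tau> x
  proof -
    obtain e where e: "e \<in> stable_space \<tau>" "x - e \<in> unstable_space \<tau>" "adapted \<tau> e \<le> proj_growth * adapted \<tau> x"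
      using ex_decomposition[OF \<tau>] by blast
    then have "P' \<tau> x = e" using P'[OF \<tau>] by blast
    then show ?thesis
      using order_trans[OF e(3) mult_left_mono[OF Cn[OF \<tau>, of x] less_imp_le[OF G]]] by simp
  qed
  have "npd_with U P' (lam / 2) D' eps"
    unfolding npd_with_def
  proof (intro conjI allI impI; (elim conjE)?)
    show "0 < lam / 2" "0 < D'" "0 \<le> eps"
      using lam_pos C G dich by (simp_all add: D'_def npd_with_def)
    show "P' t o\<^sub>L P' t = P' t" if "1 \<le> t" for t
      using P'E[OF that] P'[OF that] subspace_0[OF subspace_unstable]
      by (intro blinfun_eqI) simp
    show "P' t o\<^sub>L U t \<tau> = U t \<tau> o\<^sub>L P' \<tau>" if t: "\<tau> \<le> t" "1 \<le> \<tau>" for t \<tau>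
    proof (rule blinfun_eqI)
      fix x
      have t1: "1 \<le> t" using t by simp
      have "U t \<tau> x - U t \<tau> (P' \<tau> x) \<in> unstable_space t"
        using P'F[OF t(2), of x] unstable_invariant[OF t(2,1)] by (auto simp flip: blinfun.diff_right)
      then show "(P' t o\<^sub>L U t \<tau>) x = (U t \<tau> o\<^sub>L P' \<tau>) x"
        using P'[OF t1] stable_invariant[OF t(2,1) P'E[OF t(2), of x]] by simp
    qed
    show "bij_betw (U t \<tau>) (kerP (P' \<tau>)) (kerP (P' t))" if t: "\<tau> \<le> t" "1 \<le> \<tau>" for t \<tau>
    proof (rule bij_betw_imageI)
      have t1: "1 \<le> t" using t by simp
      show "U t \<tau> ` kerP (P' \<tau>) = kerP (P' t)"
        using unstable_invariant[OF t(2,1)] by (simp add: ker t t1)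
      show "inj_on (U t \<tau>) (kerP (P' \<tau>))"
      proof (rule inj_onI)
        fix x y assume xy: "x \<in> kerP (P' \<tau>)" "y \<in> kerP (P' \<tau>)" "U t \<tau> x = U t \<tau> y"
        then have "x - y \<in> unstable_space \<tau>"
          using subspace_diff[OF subspace_unstable] by (simp add: ker t)
        note c = unstable_cone[OF t(2) this]
        \<comment> \<open>Injectivity follows from expansion in the cone: a difference mapped to 0
          has unstable seminorm 0, and then norm 0 by the cone condition.\<close>
        have "(t / \<tau>) powr (lam / 2) * unst_seminorm \<tau> (x - y) \<le> 0"
          using cone_expand[OF t(2,1) c] xy(3) seminorm_zero[OF seminorm_unst[OF t1]]
          by (simp add: blinfun.diff_right)
        moreover have "0 < (t / \<tau>) powr (lam / 2)" using t by simp
        ultimately have "unst_seminorm \<tau> (x - y) \<le> 0" by (simp add: mult_le_0_iff)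
        then have "norm (x - y) \<le> 0" using nN[OF t(2), of "x - y"] c unfolding adapted_def by linarith
        then show "x = y" by simp
      qed
    qed
    show "norm (U t \<tau> o\<^sub>L P' \<tau>) \<le> D' * (t / \<tau>) powr - (lam / 2) * \<tau> powr eps"
      if t: "\<tau> \<le> t" "1 \<le> \<tau>" for t \<tau>
    proof (rule norm_blinfun_bound)
      show "0 \<le> D' * (t / \<tau>) powr - (lam / 2) * \<tau> powr eps" using C G by (simp add: D'_def)
      fix x
      let ?p = "(t / \<tau>) powr - (lam / 2)"
      have "norm (U t \<tau> (P' \<tau> x)) \<le> 8 * ?p * adapted \<tau> (P' \<tau> x)"
        using nN[of t "U t \<tau> (P' \<tau> x)"] stable_contract[OF t(2,1) P'E[OF t(2)], of x] t by simp
      also have "\<dots> \<le> 8 * ?p * (proj_growth * (C * \<tau> powr eps * norm x))"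
        by (intro mult_left_mono P'N t) simp
      also have "\<dots> \<le> 8 * ?p * ((1 + proj_growth) * (C * \<tau> powr eps * norm x))"
        using C by (intro mult_left_mono mult_right_mono) auto
      finally show "norm ((U t \<tau> o\<^sub>L P' \<tau>) x) \<le> D' * ?p * \<tau> powr eps * norm x"
        by (simp add: D'_def algebra_simps)
    qed
    show "\<forall>y\<in>kerP (P' t). U \<tau> t y = x - P' \<tau> x \<longrightarrow>
        norm y \<le> D' * (\<tau> / t) powr - (lam / 2) * \<tau> powr eps * norm x"
      if t: "1 \<le> t" "t \<le> \<tau>" for t \<tau> x
    proof (intro ballI impI)
      fix y assume y: "y \<in> kerP (P' t)" "U \<tau> t y = x - P' \<tau> x"
      have \<tau>: "1 \<le> \<tau>" using t by simp
      let ?p = "(\<tau> / t) powr (lam / 2)"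
      have p: "0 < ?p" using t by simp
      have c: "sta_seminorm t y \<le> unst_seminorm t y"
        using unstable_cone[OF t(1)] y(1) by (simp add: ker t)
      \<comment> \<open>The cone gives the factor 2 and \<open>cone_expand\<close> the factor 4 that
        make up the 8.\<close>
      have "?p * norm y \<le> ?p * (2 * unst_seminorm t y)"
        using nN[OF t(1), of y] c p by (intro mult_left_mono) (auto simp: adapted_def)
      also have "\<dots> \<le> 8 * adapted \<tau> (x - P' \<tau> x)"
        using cone_expand[OF t c] unst_le_adapted[OF \<tau>, of "x - P' \<tau> x"]
        unfolding y(2) by (simp add: mult_ac)
      also have "\<dots> \<le> 8 * ((1 + proj_growth) * (C * \<tau> powr eps * norm x))"
        using seminorm_diff_le[OF seminorm_adapted[OF \<tau>], of x "P' \<tau> x"] Cn[OF \<tau>, of x] P'N[OF \<tau>, of x]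
        unfolding distrib_right distrib_left mult_1_left by linarith
      finally show "norm y \<le> D' * (\<tau> / t) powr - (lam / 2) * \<tau> powr eps * norm x"
        using p by (simp add: D'_def powr_minus field_simps)
    qed
  qed
  then show ?thesis unfolding strong_npd_with_def using U_growth by blast
qed

end

section \<open>Uniform choice of the threshold for \<open>c\<close>\<close>

theorem theorem5p1:
  fixes T :: "real \<Rightarrow> real \<Rightarrow> ('a::banach \<Rightarrow>\<^sub>L 'a)" and eps :: real
  assumes "evolution_family T" and "strong_npd_with T eps"
  shows "\<exists>c0>0. \<forall>(c::real) (B :: real \<Rightarrow> ('a \<Rightarrow>\<^sub>L 'a)) (U :: real \<Rightarrow> real \<Rightarrow> ('a \<Rightarrow>\<^sub>L 'a)).
    0 < c \<and> c < c0 \<and>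
    (\<forall>x. continuous_on {1..} (\<lambda>t. blinfun_apply (B t) x)) \<and>
    (\<forall>t\<ge>1. norm (B t) \<le> c / t powr (1 + eps)) \<and>
    evolution_family U \<and>
    (\<forall>t \<tau> x. t \<ge> \<tau> \<and> \<tau> \<ge> 1 \<longrightarrow>
       ((\<lambda>s. blinfun_apply (T t s) (blinfun_apply (B s) (blinfun_apply (U s \<tau>) x)))
          has_integral (blinfun_apply (U t \<tau>) x - blinfun_apply (T t \<tau>) x)) {\<tau>..t})
    \<longrightarrow> strong_npd U"
proof -
  obtain P lam D K b where dich: "npd_with T P lam D eps" and K: "0 < K"
    and growth: "\<And>t \<tau>. \<tau> \<le> t \<Longrightarrow> 1 \<le> \<tau> \<Longrightarrow> norm (T t \<tau>) \<le> K * (t / \<tau>) powr b * \<tau> powr eps"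
    using assms(2) unfolding strong_npd_with_def by blast
  interpret strong_dichotomy T P lam D eps K "max b lam"
  proof
    fix t \<tau> :: real assume t: "\<tau> \<le> t" "1 \<le> \<tau>"
    have "(t / \<tau>) powr b \<le> (t / \<tau>) powr max b lam" using t by (intro powr_mono) auto
    then have "K * (t / \<tau>) powr b * \<tau> powr eps \<le> K * (t / \<tau>) powr max b lam * \<tau> powr eps"
      using K by (intro mult_right_mono mult_left_mono) auto
    then show "norm (T t \<tau>) \<le> K * (t / \<tau>) powr max b lam * \<tau> powr eps"
      using growth[OF t] by linarith
  qed (use assms(1) dich K in auto)
  show ?thesis
  \<comment> \<open>\<open>smallness\<close> depends only on the constants of \<open>T\<close>, so
    it can be fixed before \<open>c\<close>, \<open>B\<close> and \<open>U\<close>.\<close>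
  proof (intro exI[of _ smallness] conjI allI impI smallness_pos, elim conjE)
    fix c :: real and B :: "real \<Rightarrow> ('a \<Rightarrow>\<^sub>L 'a)" and U :: "real \<Rightarrow> real \<Rightarrow> ('a \<Rightarrow>\<^sub>L 'a)"
    assume c: "0 < c" "c < smallness" and B: "\<forall>t\<ge>1. norm (B t) \<le> c / t powr (1 + eps)"
      and U: "evolution_family U"
      and int: "\<forall>t \<tau> x. t \<ge> \<tau> \<and> \<tau> \<ge> 1 \<longrightarrow>
        ((\<lambda>s. T t s (B s (U s \<tau> x))) has_integral (U t \<tau> x - T t \<tau> x)) {\<tau>..t}"
    interpret close_evolution T P lam D eps K "max b lam" U
    proof
      show "adapted t (U t \<tau> x - T t \<tau> x) \<le> adapted \<tau> x / 8"
        if "1 \<le> \<tau>" "\<tau> \<le> t" "t \<le> ratio * \<tau>" for t \<tau> x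
        using B int by (intro perturbation_close[OF U c _ _ that, of B]) simp_all
    qed (rule U)
    show "strong_npd U" unfolding strong_npd_def using strong_npd_close by blast
  qed
qed

end
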